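(* The category $\mathsf{Graph}$ of (reflexive) graphs carries precisely two closed symmetric monoidal products, up to natural isomorphism of the tensor product functors: the box product $\square$ and the categorical product $\boxtimes$. That is, $\square$ and $\boxtimes$ are each the tensor product of a closed symmetric monoidal structure on $\mathsf{Graph}$, they are not isomorphic as functors $\mathsf{Graph}\times\mathsf{Graph}\to\mathsf{Graph}$, and if $\otimes\colon \mathsf{Graph}\times\mathsf{Graph}\to\mathsf{Graph}$ is the tensor product of any closed symmetric monoidal structure on $\mathsf{Graph}$, then $\otimes\cong\square$ or $\otimes\cong\boxtimes$.
   Context: Let $\mathbb{G}$ be the category generated by two objects $V,E$ and morphisms $s,t\colon V\to E$, $r\colon E\to V$, $\sigma\colon E\to E$ subject to $rs=rt=\mathrm{id}_V$, $\sigma^2=\mathrm{id}_E$, $\sigma s=t$, $\sigma t=s$, $r\sigma=r$. For $X\in\mathsf{Set}^{\mathbb{G}^{op}}$ write $X_V=X(V)$, $X_E=X(E)$. The category $\mathsf{Graph}$ is the full subcategory of $\mathsf{Set}^{\mathbb{G}^{op}}$ spanned by those $X$ for which $(s,t)\colon X_E\to X_V\times X_V$ is a monomorphism. Equivalently, an object is a set $X_V$ of vertices with a reflexive symmetric relation (having an edge), and a morphism $X\to X'$ (graph map) is a function $f\colon X_V\to X'_V$ such that whenever $v,w$ are joined by an edge, $f(v)$ and $f(w)$ are equal or joined by an edge. Write $v\sim w$ if there is an edge between $v$ and $w$. For graphs $X,X'$: - the box product $X\square X'$ has vertex set $X_V\times X'_V$, with an edge between $(v,v')$ and $(w,w')$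 iff either $v\sim w$ and $v'=w'$, or $v=w$ and $v'\sim w'$; - the categorical product $X\boxtimes X'$ has vertex set $X_V\times X'_V$, with an edge between $(v,v')$ and $(w,w')$ iff ($v=w$ or $v\sim w$) and ($v'=w'$ or $v'\sim w'$). Both are functorial, acting on graph maps by $(f,f')\mapsto f\times f'$ on vertices. A symmetric monoidal category $(\mathscr{C},\otimes,I)$ is closed if for every object $a$ the functor $a\otimes-\colon\mathscr{C}\to\mathscr{C}$ has a right adjoint. *)

theory Defs
  imports "HOL-Library.FuncSet" "HOL-Library.Equipollence"
begin

section \<open>Categories, functors, natural isomorphisms, adjunctions\<close>

record ('o, 'm) cat =
  Obj :: "'o set"
  Arr :: "'m set"
  Dom :: "'m \<Rightarrow> 'o"
  Cod :: "'m \<Rightarrow> 'o"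
  Ident :: "'o \<Rightarrow> 'm"
  Comp :: "'m \<Rightarrow> 'm \<Rightarrow> 'm"  (infixl "\<cdot>\<index>" 70)

definition Hom :: "('o, 'm) cat \<Rightarrow> 'o \<Rightarrow> 'o \<Rightarrow> 'm set" where
  "Hom C a b = {f \<in> Arr C. Dom C f = a \<and> Cod C f = b}"

locale category =
  fixes C :: "('o, 'm) cat" (structure)
  assumes dom_Obj: "f \<in> Arr C \<Longrightarrow> Dom C f \<in> Obj C"
    and cod_Obj: "f \<in> Arr C \<Longrightarrow> Cod C f \<in> Obj C"
    and id_Hom: "a \<in> Obj C \<Longrightarrow> Ident C a \<in> Hom C a a"
    and comp_Hom: "\<lbrakk>f \<in> Hom C a b; g \<in> Hom C b c\<rbrakk> \<Longrightarrow> g \<cdot> f \<in> Hom C a c"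
    and comp_id: "f \<in> Hom C a b \<Longrightarrow> f \<cdot> Ident C a = f"
    and id_comp: "f \<in> Hom C a b \<Longrightarrow> Ident C b \<cdot> f = f"
    and comp_assoc: "\<lbrakk>f \<in> Hom C a b; g \<in> Hom C b c; h \<in> Hom C c d\<rbrakk>
          \<Longrightarrow> (h \<cdot> g) \<cdot> f = h \<cdot> (g \<cdot> f)"

definition iso :: "('o, 'm) cat \<Rightarrow> 'm \<Rightarrow> bool" where
  "iso C f \<longleftrightarrow> f \<in> Arr C \<and>
     (\<exists>g \<in> Hom C (Cod C f) (Dom C f).
        Comp C g f = Ident C (Dom C f) \<and> Comp C f g = Ident C (Cod C f))"

definition prod_cat :: "('o, 'm) cat \<Rightarrow> ('p, 'n) cat \<Rightarrow> ('o \<times> 'p, 'm \<times> 'n) cat"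
    (infixr "\<times>\<^sub>C" 80) where
  "C \<times>\<^sub>C D =
    \<lparr>Obj = Obj C \<times> Obj D,
     Arr = Arr C \<times> Arr D,
     Dom = map_prod (Dom C) (Dom D),
     Cod = map_prod (Cod C) (Cod D),
     Ident = map_prod (Ident C) (Ident D),
     Comp = (\<lambda>(g, g') (f, f'). (Comp C g f, Comp D g' f'))\<rparr>"

record ('o, 'm, 'p, 'n) ftor =
  on_obj :: "'o \<Rightarrow> 'p"
  on_arr :: "'m \<Rightarrow> 'n"

definition id_ftor :: "('o, 'm, 'o, 'm) ftor" where
  "id_ftor = \<lparr>on_obj = id, on_arr = id\<rparr>"

definition comp_ftor ::
    "('p, 'n, 'q, 'k) ftor \<Rightarrow> ('o, 'm, 'p, 'n) ftor \<Rightarrow> ('o, 'm, 'q, 'k) ftor"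
    (infixl "\<circ>\<^sub>F" 70) where
  "G \<circ>\<^sub>F F = \<lparr>on_obj = on_obj G \<circ> on_obj F, on_arr = on_arr G \<circ> on_arr F\<rparr>"

locale cat_functor =
  C: category C + D: category D
  for C :: "('o, 'm) cat" and D :: "('p, 'n) cat" +
  fixes F :: "('o, 'm, 'p, 'n) ftor"
  assumes map_Obj: "a \<in> Obj C \<Longrightarrow> on_obj F a \<in> Obj D"
    and map_Hom: "f \<in> Hom C a b \<Longrightarrow> on_arr F f \<in> Hom D (on_obj F a) (on_obj F b)"
    and map_Id: "a \<in> Obj C \<Longrightarrow> on_arr F (Ident C a) = Ident D (on_obj F a)"
    and map_Comp: "\<lbrakk>f \<in> Hom C a b; g \<in> Hom C b c\<rbrakk>
          \<Longrightarrow> on_arr F (Comp C g f) = Comp D (on_arr F g) (on_arr F f)"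

locale nat_trans =
  F: cat_functor C D F + G: cat_functor C D G
  for C :: "('o, 'm) cat" and D :: "('p, 'n) cat"
    and F G :: "('o, 'm, 'p, 'n) ftor" +
  fixes \<eta> :: "'o \<Rightarrow> 'n"
  assumes component: "a \<in> Obj C \<Longrightarrow> \<eta> a \<in> Hom D (on_obj F a) (on_obj G a)"
    and natural: "f \<in> Hom C a b
          \<Longrightarrow> Comp D (on_arr G f) (\<eta> a) = Comp D (\<eta> b) (on_arr F f)"

locale nat_iso = nat_trans +
  assumes component_iso: "a \<in> Obj C \<Longrightarrow> iso D (\<eta> a)"

definition naturally_isomorphic ::
    "('o, 'm) cat \<Rightarrow> ('p, 'n) cat \<Rightarrow> ('o, 'm, 'p, 'n) ftor \<Rightarrow> ('o, 'm, 'p, 'n) ftor \<Rightarrow> bool" where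
  "naturally_isomorphic C D F G \<longleftrightarrow> (\<exists>\<eta>. nat_iso C D F G \<eta>)"

locale adjunction =
  unit: nat_trans C C id_ftor "G \<circ>\<^sub>F F" \<eta> + counit: nat_trans D D "F \<circ>\<^sub>F G" id_ftor \<epsilon> +
  left: cat_functor C D F + right: cat_functor D C G
  for C :: "('o, 'm) cat" and D :: "('p, 'n) cat"
    and F :: "('o, 'm, 'p, 'n) ftor" and G :: "('p, 'n, 'o, 'm) ftor"
    and \<eta> :: "'o \<Rightarrow> 'm" and \<epsilon> :: "'p \<Rightarrow> 'n" +
  assumes triangle_left:
      "c \<in> Obj C \<Longrightarrow> Comp D (\<epsilon> (on_obj F c)) (on_arr F (\<eta> c)) = Ident D (on_obj F c)"
    and triangle_right:
      "d \<in> Obj D \<Longrightarrow> Comp C (on_arr G (\<epsilon> d)) (\<eta> (on_obj G d)) = Ident C (on_obj G d)"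

definition has_right_adjoint ::
    "('o, 'm) cat \<Rightarrow> ('p, 'n) cat \<Rightarrow> ('o, 'm, 'p, 'n) ftor \<Rightarrow> bool" where
  "has_right_adjoint C D F \<longleftrightarrow> (\<exists>G \<eta> \<epsilon>. adjunction C D F G \<eta> \<epsilon>)"


section \<open>Closed symmetric monoidal structures\<close>

type_synonym ('o, 'm) bifunctor = "('o \<times> 'o, 'm \<times> 'm, 'o, 'm) ftor"

locale symmetric_monoidal =
  category C + T: cat_functor "C \<times>\<^sub>C C" C T
  for C :: "('o, 'm) cat" (structure) and T :: "('o, 'm) bifunctor" +
  fixes I :: 'o
    and \<alpha> :: "'o \<times> 'o \<times> 'o \<Rightarrow> 'm"
    and l r :: "'o \<Rightarrow> 'm"
    and \<gamma> :: "'o \<times> 'o \<Rightarrow> 'm"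
    and tensor :: "'o \<Rightarrow> 'o \<Rightarrow> 'o"  (infixr "\<otimes>" 75)
    and tensor_arr :: "'m \<Rightarrow> 'm \<Rightarrow> 'm"  (infixr "\<otimes>\<^sub>m" 75)
  defines "a \<otimes> b \<equiv> on_obj T (a, b)"
    and "f \<otimes>\<^sub>m g \<equiv> on_arr T (f, g)"
  assumes unit_Obj: "I \<in> Obj C"
    and associator: "nat_iso (C \<times>\<^sub>C C \<times>\<^sub>C C) C
          \<lparr>on_obj = (\<lambda>(a, b, c). (a \<otimes> b) \<otimes> c), on_arr = (\<lambda>(f, g, h). (f \<otimes>\<^sub>m g) \<otimes>\<^sub>m h)\<rparr>
          \<lparr>on_obj = (\<lambda>(a, b, c). a \<otimes> (b \<otimes> c)), on_arr = (\<lambda>(f, g, h). f \<otimes>\<^sub>m (g \<otimes>\<^sub>m h))\<rparr> \<alpha>"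
    and left_unitor: "nat_iso C C
          \<lparr>on_obj = (\<lambda>a. I \<otimes> a), on_arr = (\<lambda>f. Ident C I \<otimes>\<^sub>m f)\<rparr> id_ftor l"
    and right_unitor: "nat_iso C C
          \<lparr>on_obj = (\<lambda>a. a \<otimes> I), on_arr = (\<lambda>f. f \<otimes>\<^sub>m Ident C I)\<rparr> id_ftor r"
    and symmetry: "nat_iso (C \<times>\<^sub>C C) C
          \<lparr>on_obj = (\<lambda>(a, b). a \<otimes> b), on_arr = (\<lambda>(f, g). f \<otimes>\<^sub>m g)\<rparr>
          \<lparr>on_obj = (\<lambda>(a, b). b \<otimes> a), on_arr = (\<lambda>(f, g). g \<otimes>\<^sub>m f)\<rparr> \<gamma>"
    and pentagon: "\<lbrakk>a \<in> Obj C; b \<in> Obj C; c \<in> Obj C; d \<in> Obj C\<rbrakk> \<Longrightarrow>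
          \<alpha> (a, b, c \<otimes> d) \<cdot> \<alpha> (a \<otimes> b, c, d)
          = (Ident C a \<otimes>\<^sub>m \<alpha> (b, c, d)) \<cdot> \<alpha> (a, b \<otimes> c, d) \<cdot> (\<alpha> (a, b, c) \<otimes>\<^sub>m Ident C d)"
    and triangle: "\<lbrakk>a \<in> Obj C; b \<in> Obj C\<rbrakk> \<Longrightarrow>
          (Ident C a \<otimes>\<^sub>m l b) \<cdot> \<alpha> (a, I, b) = r a \<otimes>\<^sub>m Ident C b"
    and hexagon: "\<lbrakk>a \<in> Obj C; b \<in> Obj C; c \<in> Obj C\<rbrakk> \<Longrightarrow>
          \<alpha> (b, c, a) \<cdot> \<gamma> (a, b \<otimes> c) \<cdot> \<alpha> (a, b, c)
          = (Ident C b \<otimes>\<^sub>m \<gamma> (a, c)) \<cdot> \<alpha> (b, a, c) \<cdot> (\<gamma> (a, b) \<otimes>\<^sub>m Ident C c)"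
    and symmetry_involutive: "\<lbrakk>a \<in> Obj C; b \<in> Obj C\<rbrakk> \<Longrightarrow>
          \<gamma> (b, a) \<cdot> \<gamma> (a, b) = Ident C (a \<otimes> b)"

definition tensor_left :: "('o, 'm) cat \<Rightarrow> ('o, 'm) bifunctor \<Rightarrow> 'o \<Rightarrow> ('o, 'm, 'o, 'm) ftor" where
  "tensor_left C T a =
    \<lparr>on_obj = (\<lambda>b. on_obj T (a, b)), on_arr = (\<lambda>f. on_arr T (Ident C a, f))\<rparr>"

definition closed_symmetric_monoidal_product :: "('o, 'm) cat \<Rightarrow> ('o, 'm) bifunctor \<Rightarrow> bool" where
  "closed_symmetric_monoidal_product C T \<longleftrightarrow>
     (\<exists>I \<alpha> l r \<gamma>. symmetric_monoidal C T I \<alpha> l r \<gamma>) \<and>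
     (\<forall>a \<in> Obj C. has_right_adjoint C C (tensor_left C T a))"


section \<open>Universes of small sets\<close>

text \<open>
  The sets of the theory are the small subsets of a type \<open>'u\<close>, i.e. those of cardinality
  less than that of \<open>'u\<close>. The condition \<open>universe\<close> says that the cardinality
  \<open>\<kappa>\<close> of \<open>'u\<close> is infinite, a strong limit, and regular. Such a \<open>'u\<close> is in
  bijection with the Grothendieck universe \<open>V\<^sub>\<kappa>\<close>, and the subsets of \<open>V\<^sub>\<kappa>\<close> of
  cardinality less than \<open>\<kappa>\<close> are precisely its elements. Uncountability is not required:
  \<open>\<kappa> = \<omega>\<close> is the universe of hereditarily finite sets.
\<close>

definition small :: "'u set \<Rightarrow> bool" where
  "small A \<longleftrightarrow> A \<prec> (UNIV :: 'u set)"

definition universe :: "'u itself \<Rightarrow> bool" where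
  "universe (_ :: 'u itself) \<longleftrightarrow>
     infinite (UNIV :: 'u set) \<and>
     (\<forall>A :: 'u set. small A \<longrightarrow> Pow A \<prec> (UNIV :: 'u set)) \<and>
     (\<forall>(A :: 'u set) (B :: 'u \<Rightarrow> 'u set).
        small A \<and> (\<forall>a \<in> A. small (B a)) \<longrightarrow> small (\<Union>a \<in> A. B a))"


section \<open>The category of reflexive graphs\<close>

record 'u rgraph =
  verts :: "'u set"
  edges :: "'u rel"

definition is_rgraph :: "'u rgraph \<Rightarrow> bool" where
  "is_rgraph X \<longleftrightarrow>
     small (verts X) \<and> edges X \<subseteq> verts X \<times> verts X \<and>
     (\<forall>v \<in> verts X. (v, v) \<in> edges X) \<and> sym (edges X)"

record 'u gmap =
  src :: "'u rgraph"
  tgt :: "'u rgraph"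
  fn :: "'u \<Rightarrow> 'u"

text \<open>
  The vertex function of a graph map is \<open>undefined\<close> outside the vertices of its source, so
  that equality of graph maps is equality of functions on vertices.
\<close>

definition is_gmap :: "'u gmap \<Rightarrow> bool" where
  "is_gmap f \<longleftrightarrow>
     is_rgraph (src f) \<and> is_rgraph (tgt f) \<and>
     fn f \<in> verts (src f) \<rightarrow>\<^sub>E verts (tgt f) \<and>
     (\<forall>(v, w) \<in> edges (src f). fn f v = fn f w \<or> (fn f v, fn f w) \<in> edges (tgt f))"

definition Graph :: "('u rgraph, 'u gmap) cat" where
  "Graph =
    \<lparr>Obj = {X. is_rgraph X},
     Arr = {f. is_gmap f},
     Dom = src,
     Cod = tgt,
     Ident = (\<lambda>X. \<lparr>src = X, tgt = X, fn = restrict id (verts X)\<rparr>),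
     Comp = (\<lambda>g f. \<lparr>src = src f, tgt = tgt g, fn = compose (verts (src f)) (fn g) (fn f)\<rparr>)\<rparr>"


section \<open>The box product and the categorical product\<close>

text \<open>
  Vertices of a product have to lie in \<open>'u\<close> again: the ordered pair \<open>(v, v')\<close> is encoded
  as \<open>p (v, v')\<close>, where \<open>p\<close> is an injective pairing function on the universe.
\<close>

definition box_edge :: "'u rgraph \<Rightarrow> 'u rgraph \<Rightarrow> 'u \<times> 'u \<Rightarrow> 'u \<times> 'u \<Rightarrow> bool" where
  "box_edge X X' = (\<lambda>(v, v') (w, w').
     ((v, w) \<in> edges X \<and> v' = w') \<or> (v = w \<and> (v', w') \<in> edges X'))"

definition cat_edge :: "'u rgraph \<Rightarrow> 'u rgraph \<Rightarrow> 'u \<times> 'u \<Rightarrow> 'u \<times> 'u \<Rightarrow> bool" where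
  "cat_edge X X' = (\<lambda>(v, v') (w, w').
     (v = w \<or> (v, w) \<in> edges X) \<and> (v' = w' \<or> (v', w') \<in> edges X'))"

definition product_graph ::
    "('u \<times> 'u \<Rightarrow> 'u) \<Rightarrow> ('u rgraph \<Rightarrow> 'u rgraph \<Rightarrow> 'u \<times> 'u \<Rightarrow> 'u \<times> 'u \<Rightarrow> bool)
      \<Rightarrow> 'u rgraph \<Rightarrow> 'u rgraph \<Rightarrow> 'u rgraph" where
  "product_graph p E X X' =
    \<lparr>verts = p ` (verts X \<times> verts X'),
     edges = {(p x, p y) | x y.
       x \<in> verts X \<times> verts X' \<and> y \<in> verts X \<times> verts X' \<and> E X X' x y}\<rparr>"

definition product_ftor ::
    "('u \<times> 'u \<Rightarrow> 'u) \<Rightarrow> ('u rgraph \<Rightarrow> 'u rgraph \<Rightarrow> 'u \<times> 'u \<Rightarrow> 'u \<times> 'u \<Rightarrow> bool)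
      \<Rightarrow> ('u rgraph, 'u gmap) bifunctor" where
  "product_ftor p E =
    \<lparr>on_obj = (\<lambda>(X, X'). product_graph p E X X'),
     on_arr = (\<lambda>(f, f').
       \<lparr>src = product_graph p E (src f) (src f'),
        tgt = product_graph p E (tgt f) (tgt f'),
        fn = restrict (p \<circ> map_prod (fn f) (fn f') \<circ> inv p)
               (p ` (verts (src f) \<times> verts (src f')))\<rparr>)\<rparr>"

definition box_product :: "('u \<times> 'u \<Rightarrow> 'u) \<Rightarrow> ('u rgraph, 'u gmap) bifunctor" where
  "box_product p = product_ftor p box_edge"

definition categorical_product :: "('u \<times> 'u \<Rightarrow> 'u) \<Rightarrow> ('u rgraph, 'u gmap) bifunctor" where
  "categorical_product p = product_ftor p cat_edge"

end

theory Submission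
  imports Defs
begin

text \<open>
  Both products are closed: the internal hom \<open>[X, Z]\<close> consists of the graph maps \<open>X \<rightarrow> Z\<close>,
  with \<open>f\<close> and \<open>g\<close> joined iff \<open>(f v, g v)\<close> is an edge for every vertex \<open>v\<close> (box product),
  or \<open>(f v, g w)\<close> is one for every edge \<open>(v, w)\<close> (categorical product). They are not
  isomorphic, because only the second turns two copies of an edge into a complete graph on
  four vertices.

  For uniqueness, let \<open>\<otimes>\<close> be the tensor product of a closed symmetric monoidal structure
  with unit \<open>I\<close>. Each functor \<open>X \<otimes> -\<close> is a left adjoint, and \<open>X \<otimes> I \<cong> X\<close>, so \<open>I\<close> is not
  empty (\<open>unit_nonempty\<close>). An Eckmann-Hilton argument applied to constant endomaps of \<open>I\<close>
  shows that \<open>I\<close> has a single vertex (\<open>unit_subsingleton\<close>). Hence \<open>I\<close> is terminal and its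
  maps to \<open>X\<close> are the vertices of \<open>X\<close>. Projections \<open>X \<otimes> Y \<rightarrow> X \<otimes> I \<cong> X\<close>, and likewise to
  \<open>Y\<close>, identify the vertices of \<open>X \<otimes> Y\<close> with the pairs of vertices; that there are no
  others (\<open>pair_surj\<close>) uses the adjunction again. Moreover the edges of \<open>X \<otimes> Y\<close> lie
  between those of the box product and those of the categorical product.

  It remains to see whether edges \<open>(x, x')\<close> and \<open>(y, y')\<close> give a diagonal edge from
  \<open>(x, y)\<close> to \<open>(x', y')\<close>. The universal case is \<open>K \<otimes> K\<close> for the graph \<open>K\<close> with one edge,
  where by symmetry either both diagonals are edges or neither is. In the first case
  naturality yields all diagonals, and \<open>\<otimes>\<close> is the categorical product. In the second,
  preservation of colimits in both variables (\<open>extends_glue2\<close>) reduces the claim that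
  \<open>X \<otimes> Y\<close> has no more edges than the box product to the case of \<open>K \<otimes> K\<close>.
\<close>

section \<open>Product categories\<close>

lemma Obj_prod: "Obj (C \<times>\<^sub>C D) = Obj C \<times> Obj D"
  by (simp add: prod_cat_def)

lemma Hom_prod: "Hom (C \<times>\<^sub>C D) a b = Hom C (fst a) (fst b) \<times> Hom D (snd a) (snd b)"
  by (cases a; cases b) (auto simp: Hom_def prod_cat_def)

lemma category_prod:
  assumes "category C" "category D" shows "category (C \<times>\<^sub>C D)"
proof -
  interpret C: category C by fact
  interpret D: category D by fact
  show ?thesis
    apply unfold_locales
    apply (auto simp: Hom_prod)
    apply (auto simp: prod_cat_def C.dom_Obj D.dom_Obj C.cod_Obj D.cod_Obj C.id_Hom D.id_Hom
        C.comp_Hom D.comp_Hom C.comp_id D.comp_id C.id_comp D.id_comp C.comp_assoc D.comp_assoc)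
    done
qed

section \<open>Right adjoints as couniversal arrows\<close>

text \<open>
  An arrow \<open>e : F g \<rightarrow> d\<close> that is terminal among the arrows from \<open>F\<close> to \<open>d\<close>: every
  \<open>f : F c \<rightarrow> d\<close> is \<open>e \<cdot> F k\<close> for a unique \<open>k : c \<rightarrow> g\<close>. For \<open>F = a \<otimes> -\<close> these are the
  internal hom \<open>g = [a, d]\<close> and its evaluation \<open>e\<close>.
\<close>

definition couniversal ::
    "('o, 'm) cat \<Rightarrow> ('p, 'n) cat \<Rightarrow> ('o, 'm, 'p, 'n) ftor \<Rightarrow> 'p \<Rightarrow> 'o \<Rightarrow> 'n \<Rightarrow> bool" where
  "couniversal C D F d g e \<longleftrightarrow> g \<in> Obj C \<and> e \<in> Hom D (on_obj F g) d \<and>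
     (\<forall>c \<in> Obj C. \<forall>f \<in> Hom D (on_obj F c) d.
        \<exists>!k. k \<in> Hom C c g \<and> Comp D e (on_arr F k) = f)"

text \<open>
  A functor has a right adjoint iff every object of its target admits a couniversal
  arrow. The remaining proofs speak of adjoints only through this characterization.
\<close>

lemma has_right_adjointI:
  assumes "cat_functor C D F" and "\<And>d. d \<in> Obj D \<Longrightarrow> \<exists>g e. couniversal C D F d g e"
  shows "has_right_adjoint C D F"
proof -
  interpret F: cat_functor C D F by fact
  obtain g e where ge: "\<And>d. d \<in> Obj D \<Longrightarrow> couniversal C D F d (g d) (e d)"
    using assms(2) by metis
  have gO: "g d \<in> Obj C" and eH: "e d \<in> Hom D (on_obj F (g d)) d" if "d \<in> Obj D" for d
    using ge[OF that] by (auto simp: couniversal_def)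
  have objs: "a \<in> Obj D" "b \<in> Obj D" if "f \<in> Hom D a b" for f a b
    using that F.D.dom_Obj F.D.cod_Obj by (auto simp: Hom_def)
  have objsC: "a \<in> Obj C" "b \<in> Obj C" if "f \<in> Hom C a b" for f a b
    using that F.C.dom_Obj F.C.cod_Obj by (auto simp: Hom_def)
  define tr where "tr c d f = (THE k. k \<in> Hom C c (g d) \<and> Comp D (e d) (on_arr F k) = f)" for c d f
  have tr: "tr c d f \<in> Hom C c (g d)" "Comp D (e d) (on_arr F (tr c d f)) = f"
    if "c \<in> Obj C" "f \<in> Hom D (on_obj F c) d" for c d f
  proof -
    have "\<exists>!k. k \<in> Hom C c (g d) \<and> Comp D (e d) (on_arr F k) = f"
      using ge[of d] objs[OF that(2)] that by (simp add: couniversal_def)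
    from theI'[OF this] show "tr c d f \<in> Hom C c (g d)" "Comp D (e d) (on_arr F (tr c d f)) = f"
      by (auto simp: tr_def)
  qed
  have uniq: "k = k'"
    if "k \<in> Hom C c (g d)" "k' \<in> Hom C c (g d)" "d \<in> Obj D"
      "Comp D (e d) (on_arr F k) = Comp D (e d) (on_arr F k')" for c d k k'
  proof -
    have c: "c \<in> Obj C" using objsC that(1) by blast
    have "Comp D (e d) (on_arr F k) \<in> Hom D (on_obj F c) d"
      using F.D.comp_Hom[OF F.map_Hom[OF that(1)] eH[OF that(3)]] .
    then have "\<exists>!k''. k'' \<in> Hom C c (g d) \<and> Comp D (e d) (on_arr F k'') = Comp D (e d) (on_arr F k)"
      using ge[OF that(3)] c by (simp add: couniversal_def)
    then show ?thesis using that by metis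
  qed
  define G where "G = \<lparr>on_obj = g,
      on_arr = (\<lambda>f. tr (g (Dom D f)) (Cod D f) (Comp D f (e (Dom D f))))\<rparr>"
  define \<eta> where "\<eta> c = tr c (on_obj F c) (Ident D (on_obj F c))" for c
  have Gobj: "on_obj G = g" by (simp add: G_def)
  have Garr: "on_arr G f \<in> Hom C (g a) (g b)"
    "Comp D (e b) (on_arr F (on_arr G f)) = Comp D f (e a)" if "f \<in> Hom D a b" for f a b
  proof -
    have "Comp D f (e a) \<in> Hom D (on_obj F (g a)) b"
      using F.D.comp_Hom eH that objs[OF that] by blast
    from tr[OF gO this] objs[OF that] that
    show "on_arr G f \<in> Hom C (g a) (g b)"
      "Comp D (e b) (on_arr F (on_arr G f)) = Comp D f (e a)"
      by (auto simp: G_def Hom_def)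
  qed
  have \<eta>: "\<eta> c \<in> Hom C c (g (on_obj F c))"
    "Comp D (e (on_obj F c)) (on_arr F (\<eta> c)) = Ident D (on_obj F c)" if "c \<in> Obj C" for c
    using tr[OF that F.D.id_Hom[OF F.map_Obj[OF that]]] by (auto simp: \<eta>_def)
  interpret G: cat_functor D C G
  proof (unfold_locales, goal_cases)
    case (1 a) then show ?case by (simp add: gO Gobj)
  next
    case (2 f a b) then show ?case by (simp add: Garr Gobj)
  next
    case (3 a)
    show ?case
      unfolding Gobj
      by (rule uniq[OF Garr(1)[OF F.D.id_Hom] F.C.id_Hom])
        (use 3 gO Garr(2)[OF F.D.id_Hom[OF 3]] F.map_Id
          F.D.comp_id[OF eH[OF 3]] F.D.id_comp[OF eH[OF 3]] in auto)
  next
    case (4 f a b h c)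
    have ob: "a \<in> Obj D" "b \<in> Obj D" "c \<in> Obj D" using 4 objs by blast+
    note Gf = Garr[OF 4(1)] and Gh = Garr[OF 4(2)] and Ghf = Garr[OF F.D.comp_Hom[OF 4]]
    have "Comp D (e c) (on_arr F (Comp C (on_arr G h) (on_arr G f)))
        = Comp D (Comp D (e c) (on_arr F (on_arr G h))) (on_arr F (on_arr G f))"
      using F.D.comp_assoc[OF F.map_Hom[OF Gf(1)] F.map_Hom[OF Gh(1)] eH] ob
        F.map_Comp[OF Gf(1) Gh(1)] by simp
    also have "\<dots> = Comp D h (Comp D (e b) (on_arr F (on_arr G f)))"
      using Gh(2) F.D.comp_assoc[OF F.map_Hom[OF Gf(1)] eH 4(2)] ob by simp
    also have "\<dots> = Comp D (Comp D h f) (e a)"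
      using Gf(2) F.D.comp_assoc[OF eH 4] ob by simp
    finally show ?case
      using uniq[OF Ghf(1) F.C.comp_Hom[OF Gf(1) Gh(1)] ob(3)] Ghf(2) by simp
  qed
  have "adjunction C D F G \<eta> e"
  proof (unfold_locales, goal_cases)
    case (1 a) then show ?case by (simp add: id_ftor_def)
  next
    case (2 f a b) then show ?case by (simp add: id_ftor_def)
  next
    case (3 a) then show ?case by (simp add: id_ftor_def)
  next
    case (4 f a b g) then show ?case by (simp add: id_ftor_def)
  next
    case (5 a) then show ?case by (simp add: comp_ftor_def F.map_Obj G.map_Obj)
  next
    case (6 f a b) then show ?case
      by (simp add: comp_ftor_def) (metis F.map_Hom G.map_Hom)
  next
    case (7 a) then show ?case
      by (simp add: comp_ftor_def F.map_Obj F.map_Id G.map_Id)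
  next
    case (8 f a b h c) then show ?case
      by (simp add: comp_ftor_def F.map_Comp G.map_Comp[OF F.map_Hom F.map_Hom])
  next
    case (9 a) then show ?case by (simp add: id_ftor_def comp_ftor_def Gobj \<eta>)
  next
    case (10 f a b)
    have ob: "a \<in> Obj C" "b \<in> Obj C" using 10 objsC by blast+
    note Ff = F.map_Hom[OF 10]
    note GFf = Garr[OF Ff]
    have "Comp C (on_arr G (on_arr F f)) (\<eta> a) = Comp C (\<eta> b) f"
    proof (rule uniq[OF F.C.comp_Hom[OF \<eta>(1) GFf(1)] F.C.comp_Hom[OF 10 \<eta>(1)] F.map_Obj])
      have "Comp D (e (on_obj F b)) (on_arr F (Comp C (on_arr G (on_arr F f)) (\<eta> a)))
          = Comp D (Comp D (on_arr F f) (e (on_obj F a))) (on_arr F (\<eta> a))"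
        using F.D.comp_assoc[OF F.map_Hom[OF \<eta>(1)] F.map_Hom[OF GFf(1)] eH] ob
          F.map_Comp[OF \<eta>(1) GFf(1)] GFf(2) F.map_Obj by simp
      also have "\<dots> = on_arr F f"
        using F.D.comp_assoc[OF F.map_Hom[OF \<eta>(1)] eH Ff] \<eta>(2) F.D.comp_id[OF Ff] ob F.map_Obj
        by simp
      also have "\<dots> = Comp D (Comp D (e (on_obj F b)) (on_arr F (\<eta> b))) (on_arr F f)"
        using \<eta>(2) F.D.id_comp[OF Ff] ob by simp
      also have "\<dots> = Comp D (e (on_obj F b)) (on_arr F (Comp C (\<eta> b) f))"
        using F.D.comp_assoc[OF Ff F.map_Hom[OF \<eta>(1)] eH] F.map_Comp[OF 10 \<eta>(1)] ob F.map_Obj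
        by simp
      finally show "Comp D (e (on_obj F b)) (on_arr F (Comp C (on_arr G (on_arr F f)) (\<eta> a)))
          = Comp D (e (on_obj F b)) (on_arr F (Comp C (\<eta> b) f))" .
    qed (use ob in auto)
    then show ?case by (simp add: id_ftor_def comp_ftor_def)
  next
    case (11 a) then show ?case by (simp add: comp_ftor_def F.map_Obj G.map_Obj)
  next
    case (12 f a b) then show ?case
      by (simp add: comp_ftor_def) (metis F.map_Hom G.map_Hom)
  next
    case (13 a) then show ?case
      by (simp add: comp_ftor_def G.map_Obj F.map_Id G.map_Id)
  next
    case (14 f a b h c) then show ?case
      by (simp add: comp_ftor_def G.map_Comp F.map_Comp[OF G.map_Hom G.map_Hom])
  next
    case (15 a) then show ?case by (simp add: id_ftor_def)
  next
    case (16 f a b) then show ?case by (simp add: id_ftor_def)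
  next
    case (17 a) then show ?case by (simp add: id_ftor_def)
  next
    case (18 f a b g) then show ?case by (simp add: id_ftor_def)
  next
    case (19 a) then show ?case by (simp add: id_ftor_def comp_ftor_def Gobj eH)
  next
    case (20 f a b) then show ?case by (simp add: id_ftor_def comp_ftor_def Garr)
  next
    case (21 c) then show ?case by (simp add: \<eta>)
  next
    case (22 d)
    note Ge = Garr[OF eH[OF 22]] and \<eta>g = \<eta>[OF gO[OF 22]]
    have "Comp C (on_arr G (e d)) (\<eta> (g d)) = Ident C (g d)"
    proof (rule uniq[OF F.C.comp_Hom[OF \<eta>g(1) Ge(1)] F.C.id_Hom[OF gO[OF 22]] 22])
      have "Comp D (e d) (on_arr F (Comp C (on_arr G (e d)) (\<eta> (g d))))
          = Comp D (Comp D (e d) (e (on_obj F (g d)))) (on_arr F (\<eta> (g d)))"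
        using F.D.comp_assoc[OF F.map_Hom[OF \<eta>g(1)] F.map_Hom[OF Ge(1)] eH[OF 22]]
          F.map_Comp[OF \<eta>g(1) Ge(1)] Ge(2) by simp
      also have "\<dots> = e d"
        using F.D.comp_assoc[OF F.map_Hom[OF \<eta>g(1)] eH eH[OF 22]] \<eta>g(2) F.map_Obj gO 22
          F.D.comp_id[OF eH[OF 22]] by simp
      also have "\<dots> = Comp D (e d) (on_arr F (Ident C (g d)))"
        using F.map_Id gO 22 F.D.comp_id[OF eH[OF 22]] by simp
      finally show "Comp D (e d) (on_arr F (Comp C (on_arr G (e d)) (\<eta> (g d))))
          = Comp D (e d) (on_arr F (Ident C (g d)))" .
    qed
    then show ?case by (simp add: Gobj)
  qed
  then show ?thesis by (auto simp: has_right_adjoint_def)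
qed

lemma has_right_adjointD:
  assumes "has_right_adjoint C D F" "d \<in> Obj D"
  shows "\<exists>g e. couniversal C D F d g e"
proof -
  obtain G \<eta> \<epsilon> where adj: "adjunction C D F G \<eta> \<epsilon>" using assms(1) by (auto simp: has_right_adjoint_def)
  interpret adjunction C D F G \<eta> \<epsilon> by fact
  have eps: "\<epsilon> b \<in> Hom D (on_obj F (on_obj G b)) b" if "b \<in> Obj D" for b
    using counit.component[OF that] by (simp add: comp_ftor_def id_ftor_def)
  have eta: "\<eta> b \<in> Hom C b (on_obj G (on_obj F b))" if "b \<in> Obj C" for b
    using unit.component[OF that] by (simp add: comp_ftor_def id_ftor_def)
  have epsn: "Comp D f (\<epsilon> a) = Comp D (\<epsilon> b) (on_arr F (on_arr G f))" if "f \<in> Hom D a b" for f a b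
    using counit.natural[OF that] by (simp add: comp_ftor_def id_ftor_def)
  have etan: "Comp C (on_arr G (on_arr F f)) (\<eta> a) = Comp C (\<eta> b) f" if "f \<in> Hom C a b" for f a b
    using unit.natural[OF that] by (simp add: comp_ftor_def id_ftor_def)
  have "couniversal C D F d (on_obj G d) (\<epsilon> d)"
    unfolding couniversal_def
  proof (intro conjI ballI ex1I)
    show "on_obj G d \<in> Obj C" using assms(2) by (rule right.map_Obj)
    show "\<epsilon> d \<in> Hom D (on_obj F (on_obj G d)) d" using eps assms(2) .
    fix c f assume c: "c \<in> Obj C" and f: "f \<in> Hom D (on_obj F c) d"
    let ?k = "Comp C (on_arr G f) (\<eta> c)"
    note Fc = left.map_Obj[OF c] and Gf = right.map_Hom[OF f] and ec = eta[OF c]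
    show "?k \<in> Hom C c (on_obj G d)" by (rule unit.F.C.comp_Hom[OF ec Gf])
    have "Comp D (\<epsilon> d) (on_arr F ?k) = Comp D (Comp D f (\<epsilon> (on_obj F c))) (on_arr F (\<eta> c))"
      using counit.F.C.comp_assoc[OF left.map_Hom[OF ec] left.map_Hom[OF Gf] eps[OF assms(2)]]
        left.map_Comp[OF ec Gf] epsn[OF f] by simp
    also have "\<dots> = f"
      using counit.F.C.comp_assoc[OF left.map_Hom[OF ec] eps[OF Fc] f] triangle_left[OF c]
        counit.F.C.comp_id[OF f] by simp
    finally show "Comp D (\<epsilon> d) (on_arr F ?k) = f" .
    fix k assume k: "k \<in> Hom C c (on_obj G d) \<and> Comp D (\<epsilon> d) (on_arr F k) = f"
    then have kH: "k \<in> Hom C c (on_obj G d)" by simp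
    note Gd = right.map_Obj[OF assms(2)]
    have "?k = Comp C (Comp C (on_arr G (\<epsilon> d)) (on_arr G (on_arr F k))) (\<eta> c)"
      using k right.map_Comp[OF left.map_Hom[OF kH] eps[OF assms(2)]] by simp
    also have "\<dots> = Comp C (on_arr G (\<epsilon> d)) (Comp C (\<eta> (on_obj G d)) k)"
      using unit.F.C.comp_assoc[OF ec right.map_Hom[OF left.map_Hom[OF kH]] right.map_Hom[OF eps[OF assms(2)]]]
        etan[OF kH] by simp
    also have "\<dots> = k"
      using unit.F.C.comp_assoc[OF kH eta[OF Gd] right.map_Hom[OF eps[OF assms(2)]]]
        triangle_right[OF assms(2)] unit.F.C.id_comp[OF kH] by simp
    finally show "k = ?k" by simp
  qed
  then show ?thesis by blast
qed

section \<open>Functors built from a bifunctor\<close>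

lemma cat_functor_id: "category C \<Longrightarrow> cat_functor C C id_ftor"
  by (simp add: cat_functor_def cat_functor_axioms_def id_ftor_def)

context
  fixes C :: "('o, 'm) cat" and T :: "('o, 'm) bifunctor"
  assumes T: "cat_functor (C \<times>\<^sub>C C) C T"
begin

interpretation T: cat_functor "C \<times>\<^sub>C C" C T by (rule T)

lemma bifunctor_Obj: "a \<in> Obj C \<Longrightarrow> b \<in> Obj C \<Longrightarrow> on_obj T (a, b) \<in> Obj C"
  using T.map_Obj[of "(a, b)"] by (simp add: prod_cat_def)

lemma bifunctor_Hom:
  "f \<in> Hom C a b \<Longrightarrow> g \<in> Hom C a' b' \<Longrightarrow> on_arr T (f, g) \<in> Hom C (on_obj T (a, a')) (on_obj T (b, b'))"
  using T.map_Hom[of "(f, g)" "(a, a')" "(b, b')"] by (simp add: Hom_prod)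

lemma bifunctor_Id:
  "a \<in> Obj C \<Longrightarrow> b \<in> Obj C \<Longrightarrow> on_arr T (Ident C a, Ident C b) = Ident C (on_obj T (a, b))"
  using T.map_Id[of "(a, b)"] by (simp add: prod_cat_def)

lemma bifunctor_Comp:
  assumes "f \<in> Hom C a b" "f' \<in> Hom C b c" "g \<in> Hom C a' b'" "g' \<in> Hom C b' c'"
  shows "on_arr T (Comp C f' f, Comp C g' g) = Comp C (on_arr T (f', g')) (on_arr T (f, g))"
  using T.map_Comp[of "(f, g)" "(a, a')" "(b, b')" "(f', g')" "(c, c')"] assms
  by (simp add: Hom_prod) (simp add: prod_cat_def)

lemma cat_functor_tensor_left:
  assumes "a \<in> Obj C"
  shows "cat_functor C C \<lparr>on_obj = \<lambda>b. on_obj T (a, b), on_arr = \<lambda>f. on_arr T (Ident C a, f)\<rparr>"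
proof (unfold_locales, goal_cases)
  case (4 f b c g d)
  then show ?case
    using bifunctor_Comp[OF T.D.id_Hom T.D.id_Hom, of a f b c g d] assms
    by (simp add: T.D.id_comp[OF T.D.id_Hom])
qed (auto simp: assms bifunctor_Obj bifunctor_Id intro!: bifunctor_Hom T.D.id_Hom)

lemma cat_functor_tensor_right:
  assumes "a \<in> Obj C"
  shows "cat_functor C C \<lparr>on_obj = \<lambda>b. on_obj T (b, a), on_arr = \<lambda>f. on_arr T (f, Ident C a)\<rparr>"
proof (unfold_locales, goal_cases)
  case (4 f b c g d)
  then show ?case
    using bifunctor_Comp[OF _ _ T.D.id_Hom T.D.id_Hom, of f b c g d a] assms
    by (simp add: T.D.id_comp[OF T.D.id_Hom])
qed (auto simp: assms bifunctor_Obj bifunctor_Id intro!: bifunctor_Hom T.D.id_Hom)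

lemma cat_functor_swap:
  "cat_functor (C \<times>\<^sub>C C) C
     \<lparr>on_obj = \<lambda>(a, b). on_obj T (b, a), on_arr = \<lambda>(f, g). on_arr T (g, f)\<rparr>"
  by unfold_locales
    (auto simp: Hom_prod bifunctor_Comp bifunctor_Hom, auto simp: prod_cat_def bifunctor_Obj bifunctor_Id bifunctor_Comp)

text \<open>
  The same functor as \<open>T\<close>, written with its arguments as pairs.
\<close>

lemma cat_functor_eta:
  "cat_functor (C \<times>\<^sub>C C) C
     \<lparr>on_obj = \<lambda>(a, b). on_obj T (a, b), on_arr = \<lambda>(f, g). on_arr T (f, g)\<rparr>"
  by unfold_locales
    (auto simp: Hom_prod bifunctor_Comp bifunctor_Hom, auto simp: prod_cat_def bifunctor_Obj bifunctor_Id bifunctor_Comp)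

lemma cat_functor_assoc_left:
  "cat_functor (C \<times>\<^sub>C C \<times>\<^sub>C C) C
     \<lparr>on_obj = \<lambda>(a, b, c). on_obj T (on_obj T (a, b), c),
      on_arr = \<lambda>(f, g, h). on_arr T (on_arr T (f, g), h)\<rparr>"
proof -
  interpret C2: category "C \<times>\<^sub>C C \<times>\<^sub>C C"
    by (intro category_prod T.D.category_axioms)
  show ?thesis
  proof (unfold_locales, goal_cases)
    case (4 f a b g c)
    then show ?case
      by (auto simp: Hom_prod) (auto simp: prod_cat_def bifunctor_Comp bifunctor_Hom bifunctor_Comp[OF bifunctor_Hom bifunctor_Hom])
  qed (auto simp: Hom_prod bifunctor_Hom, auto simp: prod_cat_def bifunctor_Obj bifunctor_Id)
qed

lemma cat_functor_assoc_right:
  "cat_functor (C \<times>\<^sub>C C \<times>\<^sub>C C) C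
     \<lparr>on_obj = \<lambda>(a, b, c). on_obj T (a, on_obj T (b, c)),
      on_arr = \<lambda>(f, g, h). on_arr T (f, on_arr T (g, h))\<rparr>"
proof -
  interpret C2: category "C \<times>\<^sub>C C \<times>\<^sub>C C"
    by (intro category_prod T.D.category_axioms)
  show ?thesis
  proof (unfold_locales, goal_cases)
    case (4 f a b g c)
    then show ?case
      by (auto simp: Hom_prod) (auto simp: prod_cat_def bifunctor_Comp bifunctor_Hom bifunctor_Comp[OF _ _ bifunctor_Hom bifunctor_Hom])
  qed (auto simp: Hom_prod bifunctor_Hom, auto simp: prod_cat_def bifunctor_Obj bifunctor_Id)
qed

end

lemma nat_isoI:
  assumes "cat_functor C D F" "cat_functor C D G"
    "\<And>a. a \<in> Obj C \<Longrightarrow> \<eta> a \<in> Hom D (on_obj F a) (on_obj G a)"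
    "\<And>a. a \<in> Obj C \<Longrightarrow> iso D (\<eta> a)"
    "\<And>f a b. a \<in> Obj C \<Longrightarrow> b \<in> Obj C \<Longrightarrow> f \<in> Hom C a b \<Longrightarrow>
       Comp D (on_arr G f) (\<eta> a) = Comp D (\<eta> b) (on_arr F f)"
  shows "nat_iso C D F G \<eta>"
proof -
  interpret F: cat_functor C D F by fact
  show ?thesis
    unfolding nat_iso_def nat_iso_axioms_def nat_trans_def nat_trans_axioms_def
    using assms F.C.dom_Obj F.C.cod_Obj by (auto simp: Hom_def)
qed

section \<open>The category of graphs\<close>

lemma Graph_simps [simp]:
  "Obj Graph = {X. is_rgraph X}" "Dom Graph = src" "Cod Graph = tgt"
  by (simp_all add: Graph_def)

text \<open>
  Since graphs are reflexive, a graph map is a function on vertices that preserves edges;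
  the alternative that the two images are equal is subsumed.
\<close>

lemma Hom_Graph:
  "f \<in> Hom Graph X Y \<longleftrightarrow> src f = X \<and> tgt f = Y \<and> is_rgraph X \<and> is_rgraph Y \<and>
     fn f \<in> verts X \<rightarrow>\<^sub>E verts Y \<and> (\<forall>v w. (v, w) \<in> edges X \<longrightarrow> (fn f v, fn f w) \<in> edges Y)"
proof -
  have "fn f v = fn f w \<or> (fn f v, fn f w) \<in> edges Y \<longleftrightarrow> (fn f v, fn f w) \<in> edges Y"
    if "is_rgraph X" "is_rgraph Y" "fn f \<in> verts X \<rightarrow>\<^sub>E verts Y" "(v, w) \<in> edges X" for v w
    using that by (auto simp: is_rgraph_def) (metis PiE_mem SigmaD1 subsetD)
  then show ?thesis
    by (simp add: Hom_def Graph_def is_gmap_def) blast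
qed

lemma edge_verts: "is_rgraph X \<Longrightarrow> (v, w) \<in> edges X \<Longrightarrow> v \<in> verts X \<and> w \<in> verts X"
  by (auto simp: is_rgraph_def)
lemma edge_refl: "is_rgraph X \<Longrightarrow> v \<in> verts X \<Longrightarrow> (v, v) \<in> edges X"
  by (auto simp: is_rgraph_def)
lemma edge_sym: "is_rgraph X \<Longrightarrow> (v, w) \<in> edges X \<Longrightarrow> (w, v) \<in> edges X"
  by (auto simp: is_rgraph_def sym_def)

lemma HomD:
  assumes "f \<in> Hom Graph X Y"
  shows "src f = X" "tgt f = Y" "is_rgraph X" "is_rgraph Y"
    "v \<in> verts X \<Longrightarrow> fn f v \<in> verts Y" "(v, w) \<in> edges X \<Longrightarrow> (fn f v, fn f w) \<in> edges Y"
  using assms by (auto simp: Hom_Graph)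

lemma gmap_eqI:
  assumes "f \<in> Hom Graph X Y" "g \<in> Hom Graph X Y" "\<And>v. v \<in> verts X \<Longrightarrow> fn f v = fn g v"
  shows "f = g"
proof -
  have "fn f = fn g" by (rule PiE_ext[of _ "verts X" "\<lambda>_. verts Y"])
      (use assms in \<open>auto simp: Hom_Graph\<close>)
  then show ?thesis using assms(1,2) by (auto simp: Hom_Graph)
qed

text \<open>
  The graph map with a given function on vertices, made \<open>undefined\<close> outside the source.
\<close>

definition gmap_of :: "'u rgraph \<Rightarrow> 'u rgraph \<Rightarrow> ('u \<Rightarrow> 'u) \<Rightarrow> 'u gmap" where
  "gmap_of X Y h = \<lparr>src = X, tgt = Y, fn = restrict h (verts X)\<rparr>"

lemma gmap_of_Hom:
  assumes "is_rgraph X" "is_rgraph Y" "\<And>v. v \<in> verts X \<Longrightarrow> h v \<in> verts Y"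
    "\<And>v w. (v, w) \<in> edges X \<Longrightarrow> (h v, h w) \<in> edges Y"
  shows "gmap_of X Y h \<in> Hom Graph X Y"
  using assms by (auto simp: gmap_of_def Hom_Graph dest: edge_verts)

lemma fn_gmap_of [simp]: "v \<in> verts X \<Longrightarrow> fn (gmap_of X Y h) v = h v"
  by (simp add: gmap_of_def)

lemma fn_Comp [simp]: "v \<in> verts (src f) \<Longrightarrow> fn (Comp Graph g f) v = fn g (fn f v)"
  by (simp add: Graph_def compose_def)

lemma fn_Ident [simp]: "v \<in> verts X \<Longrightarrow> fn (Ident Graph X) v = v"
  by (simp add: Graph_def)

lemma src_tgt [simp]:
  "src (Comp Graph g f) = src f" "tgt (Comp Graph g f) = tgt g"
  "src (Ident Graph X) = X" "tgt (Ident Graph X) = X"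
  "src (gmap_of X Y h) = X" "tgt (gmap_of X Y h) = Y"
  by (simp_all add: Graph_def gmap_of_def)

lemma fn_extensional:
  "fn (Comp Graph g f) \<in> extensional (verts (src f))" "fn (Ident Graph X) \<in> extensional (verts X)"
  by (simp_all add: Graph_def)

lemma Comp_Hom:
  "f \<in> Hom Graph X Y \<Longrightarrow> g \<in> Hom Graph Y Z \<Longrightarrow> Comp Graph g f \<in> Hom Graph X Z"
  by (auto simp: Hom_Graph PiE_def fn_extensional dest: edge_verts)

lemma Ident_Hom: "is_rgraph X \<Longrightarrow> Ident Graph X \<in> Hom Graph X X"
  by (auto simp: Hom_Graph PiE_def fn_extensional dest: edge_verts)

lemma category_Graph: "category (Graph :: ('u rgraph, 'u gmap) cat)"
proof (unfold_locales, goal_cases)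
  case (4 f a b g c) then show ?case by (rule Comp_Hom)
next
  case (5 f a b)
  then show ?case
    by (intro gmap_eqI[where X=a and Y=b] Comp_Hom[where Y=a] Ident_Hom) (auto simp: HomD(1-4) HomD(5))
next
  case (6 f a b)
  then show ?case
    by (intro gmap_eqI[where X=a and Y=b] Comp_Hom[where Y=b] Ident_Hom) (auto simp: HomD(1-4) HomD(5))
next
  case (7 f a b g c h d)
  then show ?case
    by (intro gmap_eqI[where X=a and Y=d] Comp_Hom) (auto simp: HomD(1) HomD(5))
qed (simp_all add: Ident_Hom, simp_all add: Graph_def is_gmap_def)

interpretation Graph: category "Graph :: ('u rgraph, 'u gmap) cat"
  by (rule category_Graph)

lemma graph_isoI:
  assumes "f \<in> Hom Graph X Y" "bij_betw (fn f) (verts X) (verts Y)"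
    "\<And>v w. v \<in> verts X \<Longrightarrow> w \<in> verts X \<Longrightarrow> (fn f v, fn f w) \<in> edges Y \<Longrightarrow> (v, w) \<in> edges X"
  shows "iso Graph f"
proof -
  let ?h = "inv_into (verts X) (fn f)"
  let ?g = "gmap_of Y X ?h"
  note f = HomD[OF assms(1)]
  have h: "?h w \<in> verts X" "fn f (?h w) = w" if "w \<in> verts Y" for w
    using that assms(2) by (auto simp: bij_betw_def inv_into_into f_inv_into_f)
  have hf: "?h (fn f v) = v" if "v \<in> verts X" for v
    using that assms(2) by (auto simp: bij_betw_def)
  have g: "?g \<in> Hom Graph Y X"
    using f h assms(3) edge_verts[OF f(4)] by (intro gmap_of_Hom) auto
  have "Comp Graph ?g f = Ident Graph X"
    using f hf by (intro gmap_eqI[OF Comp_Hom[OF assms(1) g] Ident_Hom]) auto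
  moreover have "Comp Graph f ?g = Ident Graph Y"
    using f h HomD(1)[OF g] by (intro gmap_eqI[OF Comp_Hom[OF g assms(1)] Ident_Hom]) auto
  ultimately show ?thesis
    unfolding iso_def using f g assms(1) by (auto simp: Hom_def)
qed

lemma graph_isoD:
  assumes "iso Graph f" "f \<in> Hom Graph X Y"
  shows "bij_betw (fn f) (verts X) (verts Y)"
    and "v \<in> verts X \<Longrightarrow> w \<in> verts X \<Longrightarrow> (fn f v, fn f w) \<in> edges Y \<Longrightarrow> (v, w) \<in> edges X"
proof -
  note f = HomD[OF assms(2)]
  obtain g where g: "g \<in> Hom Graph Y X" "Comp Graph g f = Ident Graph X" "Comp Graph f g = Ident Graph Y"
    using assms f by (auto simp: iso_def)
  have gf: "fn g (fn f v) = v" if "v \<in> verts X" for v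
    using arg_cong[OF g(2), of "\<lambda>h. fn h v"] that f by simp
  have fg: "fn f (fn g v) = v" if "v \<in> verts Y" for v
    using arg_cong[OF g(3), of "\<lambda>h. fn h v"] that HomD[OF g(1)] by simp
  show "bij_betw (fn f) (verts X) (verts Y)"
    by (rule bij_betw_byWitness[where f' = "fn g"]) (use gf fg f HomD(5)[OF g(1)] in auto)
  assume "v \<in> verts X" "w \<in> verts X" "(fn f v, fn f w) \<in> edges Y"
  then show "(v, w) \<in> edges X" using HomD(6)[OF g(1)] gf by metis
qed

lemma gmap_of_iso:
  assumes "is_rgraph X" "is_rgraph Y" "\<And>v. v \<in> verts X \<Longrightarrow> h v \<in> verts Y \<and> h' (h v) = v"
    "\<And>w. w \<in> verts Y \<Longrightarrow> h' w \<in> verts X \<and> h (h' w) = w"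
    "\<And>v w. v \<in> verts X \<Longrightarrow> w \<in> verts X \<Longrightarrow> (v, w) \<in> edges X \<longleftrightarrow> (h v, h w) \<in> edges Y"
  shows "gmap_of X Y h \<in> Hom Graph X Y" "iso Graph (gmap_of X Y h)"
proof -
  show *: "gmap_of X Y h \<in> Hom Graph X Y"
  proof (rule gmap_of_Hom[OF assms(1,2)])
    show "h v \<in> verts Y" if "v \<in> verts X" for v using assms(3)[OF that] by simp
    show "(h v, h w) \<in> edges Y" if "(v, w) \<in> edges X" for v w
      using edge_verts[OF assms(1) that] that assms(5) by blast
  qed
  show "iso Graph (gmap_of X Y h)"
  proof (rule graph_isoI[OF *])
    show "bij_betw (fn (gmap_of X Y h)) (verts X) (verts Y)"
      by (rule bij_betw_byWitness[where f' = h']) (use assms(3,4) in auto)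
    show "(v, w) \<in> edges X"
      if "v \<in> verts X" "w \<in> verts X" "(fn (gmap_of X Y h) v, fn (gmap_of X Y h) w) \<in> edges Y" for v w
      using that(3) assms(5)[OF that(1,2)] by (simp add: that(1,2))
  qed
qed

section \<open>Small sets\<close>

lemma small_image: "small A \<Longrightarrow> small (f ` A)" for f :: "'u \<Rightarrow> 'u"
  unfolding small_def by (meson lesspoll_trans1 image_lepoll)

lemma small_finite: "universe TYPE('u) \<Longrightarrow> finite A \<Longrightarrow> small (A :: 'u set)"
  unfolding small_def universe_def by (simp add: finite_lesspoll_infinite)

lemma small_UN:
  "universe TYPE('u) \<Longrightarrow> small (A :: 'u set) \<Longrightarrow> (\<And>a. a \<in> A \<Longrightarrow> small (B a :: 'u set)) \<Longrightarrow> small (\<Union>a\<in>A. B a)"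
  unfolding universe_def by blast

lemma small_pairs:
  fixes p :: "'u \<times> 'u \<Rightarrow> 'u"
  assumes "universe TYPE('u)" "small A" "small B"
  shows "small (p ` (A \<times> B))"
proof -
  have "p ` (A \<times> B) = (\<Union>a\<in>A. (\<lambda>b. p (a, b)) ` B)" by auto
  then show ?thesis using assms by (simp add: small_UN small_image)
qed

text \<open>
  A function is coded by its graph, so the functions from \<open>A\<close> to \<open>B\<close> inject into the
  power set of a small set, and the strong limit property applies. This is what makes
  internal homs small.
\<close>

lemma functions_lesspoll:
  fixes A B :: "'u set"
  assumes "universe TYPE('u)" "inj (p :: 'u \<times> 'u \<Rightarrow> 'u)" "small A" "small B"
  shows "(A \<rightarrow>\<^sub>E B) \<prec> (UNIV :: 'u set)"
proof -
  have "inj_on (\<lambda>f. (\<lambda>a. p (a, f a)) ` A) (A \<rightarrow>\<^sub>E B)"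
  proof (rule inj_onI)
    fix f g assume f: "f \<in> A \<rightarrow>\<^sub>E B" and g: "g \<in> A \<rightarrow>\<^sub>E B"
      and eq: "(\<lambda>a. p (a, f a)) ` A = (\<lambda>a. p (a, g a)) ` A"
    show "f = g"
    proof (rule PiE_ext[OF f g])
      fix a assume "a \<in> A"
      then have "p (a, f a) \<in> (\<lambda>a. p (a, g a)) ` A" using eq by blast
      then show "f a = g a" using assms(2) by (auto dest: injD)
    qed
  qed
  then have "(A \<rightarrow>\<^sub>E B) \<lesssim> Pow (p ` (A \<times> B))"
    unfolding lepoll_def by (intro exI[of _ "\<lambda>f. (\<lambda>a. p (a, f a)) ` A"] conjI) auto
  moreover have "Pow (p ` (A \<times> B)) \<prec> (UNIV :: 'u set)"
    using small_pairs[OF assms(1,3,4), of p] assms(1) by (simp add: universe_def)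
  ultimately show ?thesis by (rule lesspoll_trans1)
qed

section \<open>Points, edges and constant maps\<close>

text \<open>
  The graph with one vertex, which is the unit of both products. The choice of the vertex
  is immaterial.
\<close>

definition point :: "'u rgraph" where
  "point = \<lparr>verts = {undefined}, edges = {(undefined, undefined)}\<rparr>"

lemma verts_point [simp]: "verts point = {undefined}" and edges_point [simp]: "edges point = {(undefined, undefined)}"
  by (simp_all add: point_def)

lemma point_rgraph: "universe TYPE('u) \<Longrightarrow> is_rgraph (point :: 'u rgraph)"
  by (simp add: is_rgraph_def small_finite sym_def)

text \<open>
  The complete graph on \<open>a\<close> and \<open>b\<close>, which for \<open>a \<noteq> b\<close> is a single edge. Maps out of it
  are edges, possibly degenerate; any function into it is a graph map.
\<close>

definition complete_pair :: "'u \<Rightarrow> 'u \<Rightarrow> 'u rgraph" where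
  "complete_pair a b = \<lparr>verts = {a, b}, edges = {a, b} \<times> {a, b}\<rparr>"

lemma verts_complete_pair [simp]: "verts (complete_pair a b) = {a, b}"
  and edges_complete_pair [simp]: "edges (complete_pair a b) = {a, b} \<times> {a, b}"
  by (simp_all add: complete_pair_def)

lemma complete_pair_rgraph: "universe TYPE('u) \<Longrightarrow> is_rgraph (complete_pair a b :: 'u rgraph)"
  by (auto simp: is_rgraph_def small_finite sym_def)

definition const_gmap :: "'u rgraph \<Rightarrow> 'u rgraph \<Rightarrow> 'u \<Rightarrow> 'u gmap" where
  "const_gmap X Y y = gmap_of X Y (\<lambda>_. y)"

lemma const_gmap_Hom: "is_rgraph X \<Longrightarrow> is_rgraph Y \<Longrightarrow> y \<in> verts Y \<Longrightarrow> const_gmap X Y y \<in> Hom Graph X Y"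
  by (auto simp: const_gmap_def edge_refl intro!: gmap_of_Hom)

lemma fn_const_gmap [simp]: "x \<in> verts X \<Longrightarrow> fn (const_gmap X Y y) x = y"
  by (simp add: const_gmap_def)

section \<open>The two products as functors\<close>

text \<open>
  The box product and the categorical product are treated together. As \<open>p\<close> is only
  injective, its inverse is meaningful on its range alone.
\<close>

locale graph_product =
  fixes p :: "'u \<times> 'u \<Rightarrow> 'u"
    and E :: "'u rgraph \<Rightarrow> 'u rgraph \<Rightarrow> 'u \<times> 'u \<Rightarrow> 'u \<times> 'u \<Rightarrow> bool"
  assumes univ: "universe TYPE('u)" and inj_p: "inj p" and E: "E = box_edge \<or> E = cat_edge"
begin

abbreviation "P \<equiv> product_graph p E"
abbreviation "T \<equiv> product_ftor p E"

lemma inv_p [simp]: "inv p (p z) = z"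
  using inj_p by simp

lemma p_eq [simp]: "p z = p z' \<longleftrightarrow> z = z'"
  using inj_p by (auto dest: injD)

lemma T_obj [simp]: "on_obj T (X, Y) = P X Y"
  by (simp add: product_ftor_def)

lemma verts_P: "verts (P X Y) = p ` (verts X \<times> verts Y)"
  by (simp add: product_graph_def)

lemma p_verts [simp]: "p (x, y) \<in> verts (P X Y) \<longleftrightarrow> x \<in> verts X \<and> y \<in> verts Y"
  by (auto simp: product_graph_def)

lemma P_vertsE:
  assumes "v \<in> verts (P X Y)"
  obtains x y where "v = p (x, y)" "x \<in> verts X" "y \<in> verts Y"
  using assms by (auto simp: product_graph_def)

lemma p_edges [simp]: "(p (x, y), p (x', y')) \<in> edges (P X Y) \<longleftrightarrow>
    x \<in> verts X \<and> y \<in> verts Y \<and> x' \<in> verts X \<and> y' \<in> verts Y \<and> E X Y (x, y) (x', y')"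
  by (auto simp: product_graph_def)

lemma P_edgesE:
  assumes "(v, w) \<in> edges (P X Y)"
  obtains x y x' y' where "v = p (x, y)" "w = p (x', y')" "x \<in> verts X" "y \<in> verts Y"
    "x' \<in> verts X" "y' \<in> verts Y" "E X Y (x, y) (x', y')"
  using assms by (auto simp: product_graph_def)

lemma E_sym: "is_rgraph X \<Longrightarrow> is_rgraph Y \<Longrightarrow> E X Y z z' \<Longrightarrow> E X Y z' z"
  using E by (cases z; cases z') (auto simp: box_edge_def cat_edge_def dest: edge_sym)

lemma E_refl: "is_rgraph X \<Longrightarrow> x \<in> verts X \<Longrightarrow> E X Y (x, y) (x, y)"
  using E by (auto simp: box_edge_def cat_edge_def edge_refl)

lemma P_rgraph:
  assumes "is_rgraph X" "is_rgraph Y" shows "is_rgraph (P X Y)"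
  unfolding is_rgraph_def[of "P X Y"]
proof (intro conjI)
  show "small (verts (P X Y))"
    using assms univ by (simp add: verts_P small_pairs is_rgraph_def)
  show "edges (P X Y) \<subseteq> verts (P X Y) \<times> verts (P X Y)"
    by (auto elim!: P_edgesE)
  show "\<forall>v \<in> verts (P X Y). (v, v) \<in> edges (P X Y)"
    using assms by (auto elim!: P_vertsE simp: E_refl)
  show "sym (edges (P X Y))"
    using assms by (auto intro!: symI elim!: P_edgesE simp: E_sym)
qed

lemma E_map:
  assumes "f \<in> Hom Graph X X'" "g \<in> Hom Graph Y Y'" "E X Y (x, y) (x', y')"
  shows "E X' Y' (fn f x, fn g y) (fn f x', fn g y')"
  using E assms(3) HomD(6)[OF assms(1)] HomD(6)[OF assms(2)] by (auto simp: box_edge_def cat_edge_def)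

lemma T_Hom:
  assumes "f \<in> Hom Graph X X'" "g \<in> Hom Graph Y Y'"
  shows "on_arr T (f, g) \<in> Hom Graph (P X Y) (P X' Y')"
    and "x \<in> verts X \<Longrightarrow> y \<in> verts Y \<Longrightarrow> fn (on_arr T (f, g)) (p (x, y)) = p (fn f x, fn g y)"
proof -
  note f = HomD[OF assms(1)] and g = HomD[OF assms(2)]
  have eq: "on_arr T (f, g) = gmap_of (P X Y) (P X' Y') (p \<circ> map_prod (fn f) (fn g) \<circ> inv p)"
    using f g by (simp add: product_ftor_def gmap_of_def verts_P)
  have "gmap_of (P X Y) (P X' Y') (p \<circ> map_prod (fn f) (fn g) \<circ> inv p) \<in> Hom Graph (P X Y) (P X' Y')"
  proof (rule gmap_of_Hom, goal_cases)
    case (3 v) then show ?case using f g by (auto elim!: P_vertsE)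
  next
    case (4 v w) then show ?case
      using f(5) g(5) by (auto elim!: P_edgesE simp: E_map[OF assms])
  qed (use f g in \<open>auto intro: P_rgraph\<close>)
  then show "on_arr T (f, g) \<in> Hom Graph (P X Y) (P X' Y')" by (simp add: eq)
  show "fn (on_arr T (f, g)) (p (x, y)) = p (fn f x, fn g y)" if "x \<in> verts X" "y \<in> verts Y"
    using that by (simp add: eq)
qed

lemma T_functor: "cat_functor (Graph \<times>\<^sub>C Graph) Graph T"
proof -
  interpret G2: category "Graph \<times>\<^sub>C Graph :: ('u rgraph \<times> 'u rgraph, 'u gmap \<times> 'u gmap) cat"
    by (intro category_prod category_Graph)
  show ?thesis
  proof (unfold_locales, goal_cases)
    case (1 a) then show ?case by (auto simp: prod_cat_def intro: P_rgraph)
  next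
    case (2 f a b)
    then show ?case by (cases a; cases b) (auto simp: Hom_prod intro: T_Hom)
  next
    case (3 a)
    obtain X Y where a: "a = (X, Y)" "is_rgraph X" "is_rgraph Y"
      using 3 by (auto simp: prod_cat_def)
    have "on_arr T (Ident Graph X, Ident Graph Y) = Ident Graph (P X Y)"
      by (rule gmap_eqI[OF T_Hom(1)[OF Ident_Hom Ident_Hom] Ident_Hom])
        (use a in \<open>auto elim!: P_vertsE intro: P_rgraph simp: T_Hom(2)[OF Ident_Hom Ident_Hom]\<close>)
    then show ?case by (simp add: a) (simp add: prod_cat_def)
  next
    case (4 f a b g c)
    obtain X Y X' Y' X'' Y'' f1 f2 g1 g2 where
      eqs: "a = (X, Y)" "b = (X', Y')" "c = (X'', Y'')" "f = (f1, f2)" "g = (g1, g2)"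
      by (metis surj_pair)
    then have H: "f1 \<in> Hom Graph X X'" "f2 \<in> Hom Graph Y Y'" "g1 \<in> Hom Graph X' X''" "g2 \<in> Hom Graph Y' Y''"
      using 4 by (auto simp: Hom_prod)
    have "on_arr T (Comp Graph g1 f1, Comp Graph g2 f2) = Comp Graph (on_arr T (g1, g2)) (on_arr T (f1, f2))"
      by (rule gmap_eqI[OF T_Hom(1)[OF Comp_Hom Comp_Hom] Comp_Hom[OF T_Hom(1) T_Hom(1)]])
       (use H HomD(1,5)[OF H(1)] HomD(1,5)[OF H(2)] in
          \<open>auto elim!: P_vertsE simp: T_Hom(2) HomD(1)[OF T_Hom(1)] T_Hom(2)[OF Comp_Hom Comp_Hom]\<close>)
    then show ?case by (simp add: eqs) (simp add: prod_cat_def)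
  qed
qed

section \<open>Internal homs of the two products\<close>

text \<open>
  The two products differ only in which pairs of vertices of the first factor may occur
  over an edge of the second: equal ones for the box product, joined ones for the
  categorical product. The description \<open>E_iff\<close> of edges in these terms gives the internal
  hom uniformly.
\<close>

definition related :: "'u rgraph \<Rightarrow> 'u rel" where
  "related X = (if E = box_edge then Id_on (verts X) else edges X)"

lemma E_iff:
  assumes "is_rgraph X" "is_rgraph Y" "x \<in> verts X" "x' \<in> verts X" "y \<in> verts Y" "y' \<in> verts Y"
  shows "E X Y (x, y) (x', y') \<longleftrightarrow> (x, x') \<in> edges X \<and> y = y' \<or> (x, x') \<in> related X \<and> (y, y') \<in> edges Y"
  using E assms edge_refl[OF assms(1)] edge_refl[OF assms(2)]
  by (auto simp: related_def box_edge_def cat_edge_def)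

lemma related_props:
  assumes "is_rgraph X"
  shows "related X \<subseteq> edges X" "(x, x') \<in> related X \<Longrightarrow> (x', x) \<in> related X"
    "x \<in> verts X \<Longrightarrow> (x, x) \<in> related X"
  using assms by (auto simp: related_def edge_refl edge_sym)

text \<open>
  The internal hom \<open>[X, Z]\<close> has as vertices the graph maps \<open>X \<rightarrow> Z\<close>, coded in the universe
  by some injection \<open>c\<close>. Two of them are joined iff they send related pairs of vertices of
  \<open>X\<close> to edges of \<open>Z\<close>; for the box product this is a pointwise condition.
\<close>

lemma couniversal_internal_hom:
  assumes X: "is_rgraph X" and Z: "is_rgraph Z"
  shows "\<exists>G e. couniversal Graph Graph (tensor_left Graph T X) Z G e"
proof -
  define H where "H = {h \<in> verts X \<rightarrow>\<^sub>E verts Z. \<forall>v w. (v, w) \<in> edges X \<longrightarrow> (h v, h w) \<in> edges Z}"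
  have H_verts: "h x \<in> verts Z" if "h \<in> H" "x \<in> verts X" for h x
    using that by (auto simp: H_def)
  have less: "(verts X \<rightarrow>\<^sub>E verts Z) \<prec> (UNIV :: 'u set)"
    using functions_lesspoll[OF univ inj_p] X Z by (simp add: is_rgraph_def)
  then obtain c :: "('u \<Rightarrow> 'u) \<Rightarrow> 'u" where "inj_on c (verts X \<rightarrow>\<^sub>E verts Z)"
    by (auto simp: lesspoll_def lepoll_def)
  then have inj_c: "inj_on c H" by (rule inj_on_subset) (auto simp: H_def)
  define d where "d = inv_into H c"
  have d [simp]: "d (c h) = h" if "h \<in> H" for h using inj_c that by (simp add: d_def)
  define G where "G = \<lparr>verts = c ` H, edges = {(k, k'). k \<in> c ` H \<and> k' \<in> c ` H \<and>
      (\<forall>v w. (v, w) \<in> related X \<longrightarrow> (d k v, d k' w) \<in> edges Z)}\<rparr>"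
  have vG: "verts G = c ` H" by (simp add: G_def)
  have eG: "(c f, c g) \<in> edges G \<longleftrightarrow> (\<forall>v w. (v, w) \<in> related X \<longrightarrow> (f v, g w) \<in> edges Z)"
    if "f \<in> H" "g \<in> H" for f g
    using that by (simp add: G_def)
  have eGE: "\<exists>f\<in>H. \<exists>g\<in>H. k = c f \<and> k' = c g" if "(k, k') \<in> edges G" for k k'
    using that by (simp add: G_def image_iff)
  have G: "is_rgraph G"
    unfolding is_rgraph_def
  proof (intro conjI)
    have "c ` H \<lesssim> (verts X \<rightarrow>\<^sub>E verts Z)"
      by (rule lepoll_trans[OF image_lepoll subset_imp_lepoll]) (auto simp: H_def)
    then show "small (verts G)" unfolding vG small_def using less by (rule lesspoll_trans1)
    show "edges G \<subseteq> verts G \<times> verts G" by (auto simp: G_def)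
    show "\<forall>v \<in> verts G. (v, v) \<in> edges G"
    proof
      fix k assume "k \<in> verts G"
      then obtain f where f: "f \<in> H" "k = c f" by (auto simp: vG)
      have "(f v, f w) \<in> edges Z" if "(v, w) \<in> related X" for v w
        using f that related_props(1)[OF X] by (auto simp: H_def)
      then show "(k, k) \<in> edges G" using f by (simp add: eG)
    qed
    show "sym (edges G)"
    proof (rule symI)
      fix k k' assume kk: "(k, k') \<in> edges G"
      then obtain f g where "f \<in> H" "g \<in> H" "k = c f" "k' = c g" using eGE by blast
      with kk show "(k', k) \<in> edges G" by (simp add: eG) (meson related_props(2)[OF X] edge_sym[OF Z])
    qed
  qed
  define e where "e = gmap_of (P X G) Z (\<lambda>u. case inv p u of (x, k) \<Rightarrow> d k x)"
  have e_fn: "fn e (p (x, c h)) = h x" if "x \<in> verts X" "h \<in> H" for x h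
    using that by (simp add: e_def vG)
  have e_Hom: "e \<in> Hom Graph (P X G) Z"
    unfolding e_def
  proof (rule gmap_of_Hom[OF P_rgraph[OF X G] Z], goal_cases)
    case (1 v) then show ?case by (auto elim!: P_vertsE simp: vG H_verts)
  next
    case (2 v w)
    then show ?case
    proof (cases rule: P_edgesE)
      case (1 x k x' k')
      then obtain f g where fg: "f \<in> H" "g \<in> H" "k = c f" "k' = c g" by (auto simp: vG)
      have "(x, x') \<in> edges X \<and> k = k' \<or> (x, x') \<in> related X \<and> (k, k') \<in> edges G"
        using 1 by (simp add: E_iff[OF X G])
      then have "(f x, g x') \<in> edges Z"
      proof
        assume a: "(x, x') \<in> edges X \<and> k = k'"
        then have "f = g" using fg inj_onD[OF inj_c] by metis
        then show ?thesis using a fg by (simp add: H_def)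
      qed (use fg in \<open>simp add: eG\<close>)
      then show ?thesis using fg 1 by simp
    qed
  qed
  have "couniversal Graph Graph (tensor_left Graph T X) Z G e"
    unfolding couniversal_def
  proof (intro conjI ballI)
    show "G \<in> Obj Graph" using G by simp
    show "e \<in> Hom Graph (on_obj (tensor_left Graph T X) G) Z"
      using e_Hom by (simp add: tensor_left_def)
    fix Y :: "'u rgraph" and f
    assume "Y \<in> Obj Graph" and "f \<in> Hom Graph (on_obj (tensor_left Graph T X) Y) Z"
    then have Y: "is_rgraph Y" and f: "f \<in> Hom Graph (P X Y) Z" by (simp_all add: tensor_left_def)
    define h where "h y = (\<lambda>x\<in>verts X. fn f (p (x, y)))" for y
    have hH: "h y \<in> H" if "y \<in> verts Y" for y
      unfolding H_def
    proof (intro CollectI conjI allI impI)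
      show "h y \<in> verts X \<rightarrow>\<^sub>E verts Z"
        using that HomD(5)[OF f] by (simp add: h_def)
      fix v w assume vw: "(v, w) \<in> edges X"
      then have "v \<in> verts X" "w \<in> verts X" using edge_verts[OF X] by blast+
      then show "(h y v, h y w) \<in> edges Z"
        using that vw HomD(6)[OF f, of "p (v, y)" "p (w, y)"] by (simp add: h_def E_iff[OF X Y])
    qed
    have hedge: "(c (h y), c (h y')) \<in> edges G" if yy: "(y, y') \<in> edges Y" for y y'
    proof -
      have yv: "y \<in> verts Y" "y' \<in> verts Y" using edge_verts[OF Y yy] by auto
      have "(h y v, h y' w) \<in> edges Z" if vw: "(v, w) \<in> related X" for v w
      proof -
        have "v \<in> verts X" "w \<in> verts X" using vw related_props(1)[OF X] edge_verts[OF X] by blast+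
        then show ?thesis
          using yv yy vw HomD(6)[OF f, of "p (v, y)" "p (w, y')"] by (simp add: h_def E_iff[OF X Y])
      qed
      then show ?thesis using yv by (auto simp: eG hH)
    qed
    let ?k = "gmap_of Y G (\<lambda>y. c (h y))"
    have k: "?k \<in> Hom Graph Y G"
      by (rule gmap_of_Hom[OF Y G]) (auto simp: vG hH hedge)
    have tl: "on_arr (tensor_left Graph T X) g = on_arr T (Ident Graph X, g)" for g
      by (simp add: tensor_left_def)
    note TH = T_Hom[OF Ident_Hom[OF X]]
    show "\<exists>!k. k \<in> Hom Graph Y G \<and> Comp Graph e (on_arr (tensor_left Graph T X) k) = f"
      unfolding tl
    proof (rule ex1I[where a = ?k], intro conjI)
      show "?k \<in> Hom Graph Y G" by (rule k)
      show "Comp Graph e (on_arr T (Ident Graph X, ?k)) = f"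
        by (rule gmap_eqI[OF Comp_Hom[OF TH(1)[OF k] e_Hom] f])
          (auto elim!: P_vertsE simp: TH(2)[OF k] HomD(1)[OF TH(1)[OF k]] e_fn hH, simp add: h_def)
      fix k' assume *: "k' \<in> Hom Graph Y G \<and> Comp Graph e (on_arr T (Ident Graph X, k')) = f"
      then have k': "k' \<in> Hom Graph Y G" by simp
      show "k' = ?k"
      proof (rule gmap_eqI[OF k' k])
        fix y assume y: "y \<in> verts Y"
        then obtain g where g: "g \<in> H" "fn k' y = c g" using HomD(5)[OF k'] by (auto simp: vG)
        have "g = h y"
        proof (rule PiE_ext)
          show "g \<in> verts X \<rightarrow>\<^sub>E verts Z" "h y \<in> verts X \<rightarrow>\<^sub>E verts Z"
            using g hH[OF y] by (auto simp: H_def)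
          fix x assume x: "x \<in> verts X"
          then show "g x = h y x"
            using arg_cong[OF conjunct2[OF *], of "\<lambda>q. fn q (p (x, y))"] y g
            by (simp add: HomD(1)[OF TH(1)[OF k']] TH(2)[OF k'] e_fn h_def)
        qed
        then show "fn k' y = fn ?k y" using g y by simp
      qed
    qed
  qed
  then show ?thesis by blast
qed

end

section \<open>Monoidal structure of the two products\<close>

context graph_product
begin

lemma E_assoc:
  assumes "x \<in> verts X" "y \<in> verts Y" "z \<in> verts Z" "x' \<in> verts X" "y' \<in> verts Y" "z' \<in> verts Z"
    "is_rgraph X" "is_rgraph Y" "is_rgraph Z"
  shows "E (P X Y) Z (p (x, y), z) (p (x', y'), z') \<longleftrightarrow> E X (P Y Z) (x, p (y, z)) (x', p (y', z'))"
  using E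
proof
  assume "E = box_edge"
  then have "E A B (a, b) (a', b') \<longleftrightarrow> (a, a') \<in> edges A \<and> b = b' \<or> a = a' \<and> (b, b') \<in> edges B"
    for A B a b a' b' by (simp add: box_edge_def)
  then show ?thesis using assms by auto
next
  assume "E = cat_edge"
  then have "E A B (a, b) (a', b') \<longleftrightarrow> (a = a' \<or> (a, a') \<in> edges A) \<and> (b = b' \<or> (b, b') \<in> edges B)"
    for A B a b a' b' by (simp add: cat_edge_def)
  then show ?thesis using assms by auto
qed

lemma E_swap: "E Y X (y, x) (y', x') \<longleftrightarrow> E X Y (x, y) (x', y')"
  using E by (auto simp: box_edge_def cat_edge_def)

lemma E_point: "is_rgraph X \<Longrightarrow> x \<in> verts X \<Longrightarrow> E point X (undefined, x) (undefined, x') \<longleftrightarrow> (x, x') \<in> edges X"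
  using E by (auto simp: box_edge_def cat_edge_def edge_refl)

text \<open>
  The structural isomorphisms are the evident bijections of nested pairs; coherence is
  therefore checked vertex by vertex.
\<close>

definition "assoc X Y Z = gmap_of (P (P X Y) Z) (P X (P Y Z))
  (\<lambda>v. case inv p v of (u, z) \<Rightarrow> case inv p u of (x, y) \<Rightarrow> p (x, p (y, z)))"
definition "unit_left X = gmap_of (P point X) X (\<lambda>v. snd (inv p v))"
definition "unit_right X = gmap_of (P X point) X (\<lambda>v. fst (inv p v))"
definition "swap X Y = gmap_of (P X Y) (P Y X) (\<lambda>v. case inv p v of (x, y) \<Rightarrow> p (y, x))"

lemma src_assoc [simp]:
  "src (assoc X Y Z) = P (P X Y) Z" "src (unit_left X) = P point X" "src (unit_right X) = P X point"
  "src (swap X Y) = P X Y" "src (on_arr T (f, g)) = P (src f) (src g)"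
  by (simp_all add: assoc_def unit_left_def unit_right_def swap_def product_ftor_def)

lemma fn_T [simp]:
  "x \<in> verts (src f) \<Longrightarrow> y \<in> verts (src g) \<Longrightarrow> fn (on_arr T (f, g)) (p (x, y)) = p (fn f x, fn g y)"
  by (auto simp: product_ftor_def)

lemma fn_structure [simp]:
  "x \<in> verts X \<Longrightarrow> y \<in> verts Y \<Longrightarrow> z \<in> verts Z \<Longrightarrow> fn (assoc X Y Z) (p (p (x, y), z)) = p (x, p (y, z))"
  "x \<in> verts X \<Longrightarrow> fn (unit_left X) (p (undefined, x)) = x"
  "x \<in> verts X \<Longrightarrow> fn (unit_right X) (p (x, undefined)) = x"
  "x \<in> verts X \<Longrightarrow> y \<in> verts Y \<Longrightarrow> fn (swap X Y) (p (x, y)) = p (y, x)"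
  by (simp_all add: assoc_def unit_left_def unit_right_def swap_def)

lemma assoc_Hom:
  assumes "is_rgraph X" "is_rgraph Y" "is_rgraph Z"
  shows "assoc X Y Z \<in> Hom Graph (P (P X Y) Z) (P X (P Y Z))" "iso Graph (assoc X Y Z)"
  unfolding assoc_def
  by (rule gmap_of_iso[where h' = "\<lambda>v. case inv p v of (x, u) \<Rightarrow> case inv p u of (y, z) \<Rightarrow> p (p (x, y), z)"];
      use assms in \<open>auto intro!: P_rgraph elim!: P_vertsE simp: E_assoc\<close>)+

lemma unit_left_Hom:
  assumes "is_rgraph X"
  shows "unit_left X \<in> Hom Graph (P point X) X" "iso Graph (unit_left X)"
  unfolding unit_left_def
  by (rule gmap_of_iso[where h' = "\<lambda>x. p (undefined, x)"];
      use assms in \<open>auto intro!: P_rgraph point_rgraph univ elim!: P_vertsE simp: E_point\<close>)+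

lemma unit_right_Hom:
  assumes "is_rgraph X"
  shows "unit_right X \<in> Hom Graph (P X point) X" "iso Graph (unit_right X)"
  unfolding unit_right_def
  by (rule gmap_of_iso[where h' = "\<lambda>x. p (x, undefined)"];
      use assms in \<open>auto intro!: P_rgraph point_rgraph univ elim!: P_vertsE simp: E_point E_swap[of X point]\<close>)+

lemma swap_Hom:
  assumes "is_rgraph X" "is_rgraph Y"
  shows "swap X Y \<in> Hom Graph (P X Y) (P Y X)" "iso Graph (swap X Y)"
  unfolding swap_def
  by (rule gmap_of_iso[where h' = "\<lambda>v. case inv p v of (x, y) \<Rightarrow> p (y, x)"];
      use assms in \<open>auto intro!: P_rgraph elim!: P_vertsE simp: E_swap[of X Y]\<close>)+

lemmas arrows_Hom = Comp_Hom T_Hom(1) assoc_Hom(1) unit_left_Hom(1) unit_right_Hom(1) swap_Hom(1)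
  Ident_Hom P_rgraph point_rgraph univ

theorem symmetric_monoidal_product:
  "symmetric_monoidal Graph T point (\<lambda>(X, Y, Z). assoc X Y Z) unit_left unit_right (\<lambda>(X, Y). swap X Y)"
proof (intro symmetric_monoidal.intro symmetric_monoidal_axioms.intro category_Graph T_functor, goal_cases)
  case 1 then show ?case by (simp add: point_rgraph univ)
next
  case 2
  show ?case
  proof (rule nat_isoI[OF cat_functor_assoc_left[OF T_functor] cat_functor_assoc_right[OF T_functor]], goal_cases)
    case (1 a) then show ?case by (auto simp: Obj_prod assoc_Hom)
  next
    case (2 a) then show ?case by (auto simp: Obj_prod assoc_Hom)
  next
    case (3 f a b)
    obtain X Y Z X' Y' Z' f1 f2 f3 where
      eqs: "a = (X, Y, Z)" "b = (X', Y', Z')" "f = (f1, f2, f3)"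
      by (metis surj_pair)
    then have H: "f1 \<in> Hom Graph X X'" "f2 \<in> Hom Graph Y Y'" "f3 \<in> Hom Graph Z Z'"
      and rg: "is_rgraph X" "is_rgraph Y" "is_rgraph Z" "is_rgraph X'" "is_rgraph Y'" "is_rgraph Z'"
      using 3 by (auto simp: Hom_prod Obj_prod)
    have "Comp Graph (on_arr T (f1, on_arr T (f2, f3))) (assoc X Y Z)
       = Comp Graph (assoc X' Y' Z') (on_arr T (on_arr T (f1, f2), f3))"
      by (rule gmap_eqI, (rule H rg arrows_Hom)+)
        (use HomD(1,5)[OF H(1)] HomD(1,5)[OF H(2)] HomD(1,5)[OF H(3)] in \<open>auto elim!: P_vertsE\<close>)
    then show ?case by (simp add: eqs)
  qed
next
  case 3
  show ?case
  proof (rule nat_isoI[OF cat_functor_tensor_left[OF T_functor] cat_functor_id[OF category_Graph]], goal_cases)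
    case (4 f a b)
    then have H: "f \<in> Hom Graph a b" "is_rgraph a" "is_rgraph b" by auto
    have "Comp Graph f (unit_left a) = Comp Graph (unit_left b) (on_arr T (Ident Graph point, f))"
      by (rule gmap_eqI, (rule H arrows_Hom)+)
        (use HomD(1,5)[OF H(1)] in \<open>auto elim!: P_vertsE\<close>)
    then show ?case by (simp add: id_ftor_def)
  qed (auto simp: unit_left_Hom id_ftor_def point_rgraph univ)
next
  case 4
  show ?case
  proof (rule nat_isoI[OF cat_functor_tensor_right[OF T_functor] cat_functor_id[OF category_Graph]], goal_cases)
    case (4 f a b)
    then have H: "f \<in> Hom Graph a b" "is_rgraph a" "is_rgraph b" by auto
    have "Comp Graph f (unit_right a) = Comp Graph (unit_right b) (on_arr T (f, Ident Graph point))"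
      by (rule gmap_eqI, (rule H arrows_Hom)+)
        (use HomD(1,5)[OF H(1)] in \<open>auto elim!: P_vertsE\<close>)
    then show ?case by (simp add: id_ftor_def)
  qed (auto simp: unit_right_Hom id_ftor_def point_rgraph univ)
next
  case 5
  show ?case
  proof (rule nat_isoI[OF cat_functor_eta[OF T_functor] cat_functor_swap[OF T_functor]], goal_cases)
    case (3 f a b)
    obtain X Y X' Y' f1 f2 where eqs: "a = (X, Y)" "b = (X', Y')" "f = (f1, f2)"
      by (metis surj_pair)
    then have H: "f1 \<in> Hom Graph X X'" "f2 \<in> Hom Graph Y Y'"
      and rg: "is_rgraph X" "is_rgraph Y" "is_rgraph X'" "is_rgraph Y'"
      using 3 by (auto simp: Hom_prod Obj_prod)
    have "Comp Graph (on_arr T (f2, f1)) (swap X Y) = Comp Graph (swap X' Y') (on_arr T (f1, f2))"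
      by (rule gmap_eqI, (rule H rg arrows_Hom)+)
        (use HomD(1,5)[OF H(1)] HomD(1,5)[OF H(2)] in \<open>auto elim!: P_vertsE\<close>)
    then show ?case by (simp add: eqs)
  qed (auto simp: swap_Hom Obj_prod)
next
  case (6 a b c d)
  then have rg: "is_rgraph a" "is_rgraph b" "is_rgraph c" "is_rgraph d" by auto
  show ?case
    unfolding prod.case T_obj
    by (rule gmap_eqI, (rule rg arrows_Hom)+) (auto elim!: P_vertsE)
next
  case (7 a b)
  then have rg: "is_rgraph a" "is_rgraph b" by auto
  show ?case
    unfolding prod.case T_obj
    by (rule gmap_eqI, (rule rg arrows_Hom)+) (auto elim!: P_vertsE)
next
  case (8 a b c)
  then have rg: "is_rgraph a" "is_rgraph b" "is_rgraph c" by auto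
  show ?case
    unfolding prod.case T_obj
    by (rule gmap_eqI, (rule rg arrows_Hom)+) (auto elim!: P_vertsE)
next
  case (9 a b)
  then have rg: "is_rgraph a" "is_rgraph b" by auto
  show ?case
    unfolding prod.case T_obj
    by (rule gmap_eqI, (rule rg arrows_Hom)+) (auto elim!: P_vertsE)
qed

lemma closed_symmetric_monoidal_product_T: "closed_symmetric_monoidal_product Graph T"
  unfolding closed_symmetric_monoidal_product_def
proof (intro conjI ballI)
  show "\<exists>I \<alpha> l r \<gamma>. symmetric_monoidal Graph T I \<alpha> l r \<gamma>"
    using symmetric_monoidal_product by blast
  fix X :: "'u rgraph" assume X: "X \<in> Obj Graph"
  show "has_right_adjoint Graph Graph (tensor_left Graph T X)"
  proof (rule has_right_adjointI)
    show "cat_functor Graph Graph (tensor_left Graph T X)"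
      using cat_functor_tensor_left[OF T_functor X] by (simp add: tensor_left_def)
  qed (use X couniversal_internal_hom in auto)
qed

end

section \<open>Closed symmetric monoidal structures on graphs\<close>

text \<open>
  A closed symmetric monoidal structure on graphs, with two distinct elements of the
  universe to build the edge graph \<open>K\<close> from.
\<close>

locale closed_tensor =
  fixes T :: "('u rgraph, 'u gmap) bifunctor" and I :: "'u rgraph" and \<alpha> l r \<gamma>
    and a b :: 'u
  assumes univ: "universe TYPE('u)"
    and monoidal: "symmetric_monoidal Graph T I \<alpha> l r \<gamma>"
    and closed: "X \<in> Obj Graph \<Longrightarrow> has_right_adjoint Graph Graph (tensor_left Graph T X)"
    and ab: "a \<noteq> b"
begin

abbreviation tensor (infixr "\<otimes>" 75) where "X \<otimes> Y \<equiv> on_obj T (X, Y)"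
abbreviation tensor_map (infixr "\<otimes>\<^sub>m" 75) where "f \<otimes>\<^sub>m g \<equiv> on_arr T (f, g)"
abbreviation "K \<equiv> complete_pair a b"
abbreviation idn where "idn X \<equiv> Ident Graph X"

lemma T_functor: "cat_functor (Graph \<times>\<^sub>C Graph) Graph T"
  using monoidal by (simp add: symmetric_monoidal_def)

lemma tensor_rgraph: "is_rgraph X \<Longrightarrow> is_rgraph Y \<Longrightarrow> is_rgraph (X \<otimes> Y)"
  using bifunctor_Obj[OF T_functor, of X Y] by simp

lemmas tensor_Hom = bifunctor_Hom[OF T_functor]

lemma K_rgraph: "is_rgraph K"
  by (rule complete_pair_rgraph[OF univ])

lemma I_rgraph: "is_rgraph I"
  using monoidal by (simp add: symmetric_monoidal_def symmetric_monoidal_axioms_def)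

lemma fn_tensor_Comp:
  assumes "f \<in> Hom Graph X X'" "f' \<in> Hom Graph X' X''" "g \<in> Hom Graph Y Y'" "g' \<in> Hom Graph Y' Y''"
    "v \<in> verts (X \<otimes> Y)"
  shows "fn (f' \<otimes>\<^sub>m g') (fn (f \<otimes>\<^sub>m g) v) = fn (Comp Graph f' f \<otimes>\<^sub>m Comp Graph g' g) v"
  using bifunctor_Comp[OF T_functor assms(1-4)] assms(5) HomD(1)[OF tensor_Hom[OF assms(1,3)]] by simp

lemma nat_iso_facts:
  assumes "nat_iso C Graph F G \<eta>" "c \<in> Obj C"
  shows "\<eta> c \<in> Hom Graph (on_obj F c) (on_obj G c)"
    "bij_betw (fn (\<eta> c)) (verts (on_obj F c)) (verts (on_obj G c))"
    "v \<in> verts (on_obj F c) \<Longrightarrow> w \<in> verts (on_obj F c) \<Longrightarrow>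
      (fn (\<eta> c) v, fn (\<eta> c) w) \<in> edges (on_obj G c) \<Longrightarrow> (v, w) \<in> edges (on_obj F c)"
proof -
  interpret nat_iso C Graph F G \<eta> by fact
  show H: "\<eta> c \<in> Hom Graph (on_obj F c) (on_obj G c)" using component[OF assms(2)] .
  show "bij_betw (fn (\<eta> c)) (verts (on_obj F c)) (verts (on_obj G c))"
    using graph_isoD(1)[OF component_iso[OF assms(2)] H] .
  show "v \<in> verts (on_obj F c) \<Longrightarrow> w \<in> verts (on_obj F c) \<Longrightarrow>
      (fn (\<eta> c) v, fn (\<eta> c) w) \<in> edges (on_obj G c) \<Longrightarrow> (v, w) \<in> edges (on_obj F c)"
    using graph_isoD(2)[OF component_iso[OF assms(2)] H] .
qed

lemma nat_iso_natural:
  assumes "nat_iso C Graph F G \<eta>" "f \<in> Hom C c d" "v \<in> verts (on_obj F c)"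
  shows "fn (on_arr G f) (fn (\<eta> c) v) = fn (\<eta> d) (fn (on_arr F f) v)"
proof -
  interpret nat_iso C Graph F G \<eta> by fact
  have c: "c \<in> Obj C" using assms(2) F.C.dom_Obj by (auto simp: Hom_def)
  show ?thesis
    using arg_cong[OF natural[OF assms(2)], of "\<lambda>h. fn h v"] assms(3)
      HomD(1)[OF component[OF c]] HomD(1)[OF F.map_Hom[OF assms(2)]] by simp
qed

lemma left_unitor: "nat_iso Graph Graph
    \<lparr>on_obj = (\<lambda>X. I \<otimes> X), on_arr = (\<lambda>f. idn I \<otimes>\<^sub>m f)\<rparr> id_ftor l"
  and right_unitor: "nat_iso Graph Graph
    \<lparr>on_obj = (\<lambda>X. X \<otimes> I), on_arr = (\<lambda>f. f \<otimes>\<^sub>m idn I)\<rparr> id_ftor r"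
  and symmetry: "nat_iso (Graph \<times>\<^sub>C Graph) Graph
    \<lparr>on_obj = (\<lambda>(X, Y). X \<otimes> Y), on_arr = (\<lambda>(f, g). f \<otimes>\<^sub>m g)\<rparr>
    \<lparr>on_obj = (\<lambda>(X, Y). Y \<otimes> X), on_arr = (\<lambda>(f, g). g \<otimes>\<^sub>m f)\<rparr> \<gamma>"
  using monoidal by (simp_all add: symmetric_monoidal_def symmetric_monoidal_axioms_def)

lemma l_iso:
  assumes "is_rgraph X"
  shows "l X \<in> Hom Graph (I \<otimes> X) X" "bij_betw (fn (l X)) (verts (I \<otimes> X)) (verts X)"
    "v \<in> verts (I \<otimes> X) \<Longrightarrow> w \<in> verts (I \<otimes> X) \<Longrightarrow>
      (fn (l X) v, fn (l X) w) \<in> edges X \<Longrightarrow> (v, w) \<in> edges (I \<otimes> X)"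
  using nat_iso_facts[OF left_unitor, of X] assms by (simp_all add: id_ftor_def)

lemma r_iso:
  assumes "is_rgraph X"
  shows "r X \<in> Hom Graph (X \<otimes> I) X" "bij_betw (fn (r X)) (verts (X \<otimes> I)) (verts X)"
    "v \<in> verts (X \<otimes> I) \<Longrightarrow> w \<in> verts (X \<otimes> I) \<Longrightarrow>
      (fn (r X) v, fn (r X) w) \<in> edges X \<Longrightarrow> (v, w) \<in> edges (X \<otimes> I)"
  using nat_iso_facts[OF right_unitor, of X] assms by (simp_all add: id_ftor_def)

lemma l_natural: "f \<in> Hom Graph X Y \<Longrightarrow> v \<in> verts (I \<otimes> X) \<Longrightarrow>
    fn (l Y) (fn (idn I \<otimes>\<^sub>m f) v) = fn f (fn (l X) v)"
  using nat_iso_natural[OF left_unitor] by (simp add: id_ftor_def)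

lemma r_natural: "f \<in> Hom Graph X Y \<Longrightarrow> v \<in> verts (X \<otimes> I) \<Longrightarrow>
    fn (r Y) (fn (f \<otimes>\<^sub>m idn I) v) = fn f (fn (r X) v)"
  using nat_iso_natural[OF right_unitor] by (simp add: id_ftor_def)

lemma \<gamma>_Hom: "is_rgraph X \<Longrightarrow> is_rgraph Y \<Longrightarrow> \<gamma> (X, Y) \<in> Hom Graph (X \<otimes> Y) (Y \<otimes> X)"
  using nat_iso_facts(1)[OF symmetry, of "(X, Y)"] by (simp add: Obj_prod)

lemma \<gamma>_natural: "f \<in> Hom Graph X X' \<Longrightarrow> g \<in> Hom Graph Y Y' \<Longrightarrow> v \<in> verts (X \<otimes> Y) \<Longrightarrow>
    fn (\<gamma> (X', Y')) (fn (f \<otimes>\<^sub>m g) v) = fn (g \<otimes>\<^sub>m f) (fn (\<gamma> (X, Y)) v)"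
  using nat_iso_natural[OF symmetry, of "(f, g)" "(X, Y)" "(X', Y')"] by (simp add: Hom_prod)

lemma exponential:
  assumes "is_rgraph A" "is_rgraph Z"
  shows "\<exists>G e. is_rgraph G \<and> e \<in> Hom Graph (A \<otimes> G) Z \<and>
    (\<forall>Y f. is_rgraph Y \<longrightarrow> f \<in> Hom Graph (A \<otimes> Y) Z \<longrightarrow>
       (\<exists>!k. k \<in> Hom Graph Y G \<and> Comp Graph e (idn A \<otimes>\<^sub>m k) = f))"
proof -
  obtain G e where "couniversal Graph Graph (tensor_left Graph T A) Z G e"
    using has_right_adjointD[OF closed, of A Z] assms by auto
  then show ?thesis
    by (intro exI[of _ G] exI[of _ e]) (simp add: couniversal_def tensor_left_def)
qed

section \<open>The unit has exactly one vertex\<close>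

text \<open>
  If \<open>I\<close> were empty, then \<open>K \<otimes> I\<close>, being the value of a left adjoint at an initial
  object, would be initial, whereas it is isomorphic to \<open>K\<close>.
\<close>

lemma unit_nonempty: "verts I \<noteq> {}"
proof
  assume empty: "verts I = {}"
  obtain G e where G: "is_rgraph G" "e \<in> Hom Graph (K \<otimes> G) K"
    "\<And>Y f. is_rgraph Y \<Longrightarrow> f \<in> Hom Graph (K \<otimes> Y) K \<Longrightarrow>
       \<exists>!k. k \<in> Hom Graph Y G \<and> Comp Graph e (idn K \<otimes>\<^sub>m k) = f"
    using exponential[OF K_rgraph K_rgraph] by blast
  have KI: "is_rgraph (K \<otimes> I)" by (rule tensor_rgraph[OF K_rgraph I_rgraph])
  have "const_gmap (K \<otimes> I) K x \<in> Hom Graph (K \<otimes> I) K" if "x \<in> {a, b}" for x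
    using that by (intro const_gmap_Hom KI K_rgraph) auto
  then obtain k k' where k: "k \<in> Hom Graph I G" "Comp Graph e (idn K \<otimes>\<^sub>m k) = const_gmap (K \<otimes> I) K a"
    and k': "k' \<in> Hom Graph I G" "Comp Graph e (idn K \<otimes>\<^sub>m k') = const_gmap (K \<otimes> I) K b"
    by (meson G(3)[OF I_rgraph] insertI1 insertI2)
  have "k = k'" by (rule gmap_eqI[OF k(1) k'(1)]) (simp add: empty)
  then have eq: "const_gmap (K \<otimes> I) K a = const_gmap (K \<otimes> I) K b" using k k' by simp
  have "a \<in> fn (r K) ` verts (K \<otimes> I)" using r_iso(2)[OF K_rgraph] by (simp add: bij_betw_def)
  then obtain v where "v \<in> verts (K \<otimes> I)" by blast
  then show False using arg_cong[OF eq, of "\<lambda>h. fn h v"] ab by simp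
qed

text \<open>
  An Eckmann-Hilton argument: constant maps \<open>f\<close> and \<open>g\<close> of \<open>I\<close> induce constant maps
  \<open>f \<otimes> I\<close> and \<open>I \<otimes> g\<close> of \<open>I \<otimes> I\<close> through the unitors. These commute, so their values \<open>v\<close>
  and \<open>w\<close> agree; but both values are arbitrary.
\<close>

lemma unit_subsingleton:
  assumes "x \<in> verts I" "y \<in> verts I"
  shows "x = y"
proof -
  note I = I_rgraph and id = Ident_Hom[OF I_rgraph]
  have II: "is_rgraph (I \<otimes> I)" by (rule tensor_rgraph[OF I I])
  have surj_r: "\<exists>v \<in> verts (I \<otimes> I). fn (r I) v = z" if "z \<in> verts I" for z
    using that unfolding bij_betw_imp_surj_on[OF r_iso(2)[OF I], symmetric] by blast
  have key: "v = w" if v: "v \<in> verts (I \<otimes> I)" and w: "w \<in> verts (I \<otimes> I)" for v w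
  proof -
    let ?f = "const_gmap I I (fn (r I) v)" and ?g = "const_gmap I I (fn (l I) w)"
    have f: "?f \<in> Hom Graph I I" and g: "?g \<in> Hom Graph I I"
      using HomD(5)[OF r_iso(1)[OF I] v] HomD(5)[OF l_iso(1)[OF I] w] by (auto intro: const_gmap_Hom I)
    have fv: "fn (?f \<otimes>\<^sub>m idn I) u = v" if u: "u \<in> verts (I \<otimes> I)" for u
    proof -
      have "fn (r I) (fn (?f \<otimes>\<^sub>m idn I) u) = fn (r I) v"
        using r_natural[OF f u] HomD(5)[OF r_iso(1)[OF I] u] by simp
      then show ?thesis
        using inj_onD[OF bij_betw_imp_inj_on[OF r_iso(2)[OF I]]] v HomD(5)[OF tensor_Hom[OF f id] u] by blast
    qed
    have gw: "fn (idn I \<otimes>\<^sub>m ?g) u = w" if u: "u \<in> verts (I \<otimes> I)" for u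
    proof -
      have "fn (l I) (fn (idn I \<otimes>\<^sub>m ?g) u) = fn (l I) w"
        using l_natural[OF g u] HomD(5)[OF l_iso(1)[OF I] u] by simp
      then show ?thesis
        using inj_onD[OF bij_betw_imp_inj_on[OF l_iso(2)[OF I]]] w HomD(5)[OF tensor_Hom[OF id g] u] by blast
    qed
    have "v = fn (?f \<otimes>\<^sub>m idn I) (fn (idn I \<otimes>\<^sub>m ?g) v)"
      using fv HomD(5)[OF tensor_Hom[OF id g] v] by simp
    also have "\<dots> = fn (?f \<otimes>\<^sub>m ?g) v"
      using fn_tensor_Comp[OF id f g id v] Graph.comp_id[OF f] Graph.id_comp[OF g] by simp
    also have "\<dots> = fn (idn I \<otimes>\<^sub>m ?g) (fn (?f \<otimes>\<^sub>m idn I) v)"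
      using fn_tensor_Comp[OF f id id g v] Graph.comp_id[OF g] Graph.id_comp[OF f] by simp
    also have "\<dots> = w" using gw HomD(5)[OF tensor_Hom[OF f id] v] by simp
    finally show ?thesis .
  qed
  obtain v w where "v \<in> verts (I \<otimes> I)" "fn (r I) v = x" "w \<in> verts (I \<otimes> I)" "fn (r I) w = y"
    using surj_r assms by metis
  then show ?thesis using key by metis
qed

section \<open>Vertices of a tensor product\<close>

text \<open>
  The only vertices of \<open>I\<close> and of \<open>I \<otimes> I\<close>.
\<close>

definition "pt = (THE x. verts I = {x})"
definition "pt2 = (THE v. verts (I \<otimes> I) = {v})"

lemma verts_I: "verts I = {pt}"
proof -
  have "\<exists>!x. verts I = {x}" using unit_nonempty unit_subsingleton by (metis is_singletonI' is_singleton_def singleton_inject)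
  then show ?thesis unfolding pt_def by (rule theI')
qed

lemma verts_II: "verts (I \<otimes> I) = {pt2}"
proof -
  have "card (verts (I \<otimes> I)) = 1"
    using bij_betw_same_card[OF r_iso(2)[OF I_rgraph]] verts_I by simp
  then have "\<exists>!x. verts (I \<otimes> I) = {x}" by (auto simp: card_1_singleton_iff)
  then show ?thesis unfolding pt2_def by (rule theI')
qed

abbreviation point_map where "point_map X x \<equiv> const_gmap I X x"
abbreviation collapse where "collapse X \<equiv> const_gmap X I pt"

text \<open>
  A pair of vertices \<open>x : I \<rightarrow> X\<close> and \<open>y : I \<rightarrow> Y\<close> gives a vertex of \<open>X \<otimes> Y\<close>. Conversely,
  collapsing one factor to the unit projects \<open>X \<otimes> Y\<close> to the other factor. These identify
  the vertices of \<open>X \<otimes> Y\<close> with the pairs of vertices, naturally in \<open>X\<close> and \<open>Y\<close>.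
\<close>

definition pair where "pair X Y x y = fn (point_map X x \<otimes>\<^sub>m point_map Y y) pt2"
definition proj1 where "proj1 X Y v = fn (r X) (fn (idn X \<otimes>\<^sub>m collapse Y) v)"
definition proj2 where "proj2 X Y v = fn (l Y) (fn (collapse X \<otimes>\<^sub>m idn Y) v)"

lemma collapse_Hom: "is_rgraph X \<Longrightarrow> collapse X \<in> Hom Graph X I"
  by (simp add: const_gmap_Hom I_rgraph verts_I)

lemma point_Hom: "is_rgraph X \<Longrightarrow> x \<in> verts X \<Longrightarrow> point_map X x \<in> Hom Graph I X"
  by (simp add: const_gmap_Hom I_rgraph)

lemma pair_verts:
  "is_rgraph X \<Longrightarrow> is_rgraph Y \<Longrightarrow> x \<in> verts X \<Longrightarrow> y \<in> verts Y \<Longrightarrow> pair X Y x y \<in> verts (X \<otimes> Y)"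
  unfolding pair_def by (rule HomD(5)[OF tensor_Hom[OF point_Hom point_Hom]]) (auto simp: verts_II)

lemma Comp_point: "f \<in> Hom Graph X Y \<Longrightarrow> x \<in> verts X \<Longrightarrow> Comp Graph f (point_map X x) = point_map Y (fn f x)"
  by (rule gmap_eqI[OF Comp_Hom[OF point_Hom] point_Hom]) (auto simp: HomD(3-5) HomD(1)[OF point_Hom])

lemma Comp_collapse: "f \<in> Hom Graph X Y \<Longrightarrow> Comp Graph (collapse Y) f = collapse X"
  by (rule gmap_eqI[OF Comp_Hom[OF _ collapse_Hom] collapse_Hom]) (auto simp: HomD(1,3-5))

lemma fn_tensor_pair:
  assumes "f \<in> Hom Graph X X'" "g \<in> Hom Graph Y Y'" "x \<in> verts X" "y \<in> verts Y"
  shows "fn (f \<otimes>\<^sub>m g) (pair X Y x y) = pair X' Y' (fn f x) (fn g y)"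
  using fn_tensor_Comp[OF point_Hom assms(1) point_Hom assms(2), of x y pt2] assms
  by (simp add: pair_def verts_II HomD(3) Comp_point)

lemma proj1_Hom:
  assumes "is_rgraph X" "is_rgraph Y"
  shows "v \<in> verts (X \<otimes> Y) \<Longrightarrow> proj1 X Y v \<in> verts X"
    "(v, w) \<in> edges (X \<otimes> Y) \<Longrightarrow> (proj1 X Y v, proj1 X Y w) \<in> edges X"
  unfolding proj1_def
  using HomD(5,6)[OF r_iso(1)] HomD(5,6)[OF tensor_Hom[OF Ident_Hom collapse_Hom]] assms by blast+

lemma proj2_Hom:
  assumes "is_rgraph X" "is_rgraph Y"
  shows "v \<in> verts (X \<otimes> Y) \<Longrightarrow> proj2 X Y v \<in> verts Y"
    "(v, w) \<in> edges (X \<otimes> Y) \<Longrightarrow> (proj2 X Y v, proj2 X Y w) \<in> edges Y"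
  unfolding proj2_def
  using HomD(5,6)[OF l_iso(1)] HomD(5,6)[OF tensor_Hom[OF collapse_Hom Ident_Hom]] assms by blast+

lemma proj1_natural:
  assumes "f \<in> Hom Graph X X'" "g \<in> Hom Graph Y Y'" "v \<in> verts (X \<otimes> Y)"
  shows "proj1 X' Y' (fn (f \<otimes>\<^sub>m g) v) = fn f (proj1 X Y v)"
proof -
  note rg = HomD(3)[OF assms(1)] HomD(4)[OF assms(1)] HomD(3)[OF assms(2)] HomD(4)[OF assms(2)]
  note c = collapse_Hom[OF rg(3)] and ii = Ident_Hom[OF I_rgraph]
  have "fn (idn X' \<otimes>\<^sub>m collapse Y') (fn (f \<otimes>\<^sub>m g) v) = fn (f \<otimes>\<^sub>m collapse Y) v"
    using fn_tensor_Comp[OF assms(1) Ident_Hom[OF rg(2)] assms(2) collapse_Hom[OF rg(4)] assms(3)]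
    by (simp add: Graph.id_comp[OF assms(1)] Comp_collapse[OF assms(2)])
  also have "\<dots> = fn (f \<otimes>\<^sub>m idn I) (fn (idn X \<otimes>\<^sub>m collapse Y) v)"
    using fn_tensor_Comp[OF Ident_Hom[OF rg(1)] assms(1) c ii assms(3)]
    by (simp add: Graph.comp_id[OF assms(1)] Graph.id_comp[OF c])
  finally show ?thesis
    using r_natural[OF assms(1) HomD(5)[OF tensor_Hom[OF Ident_Hom[OF rg(1)] c] assms(3)]]
    by (simp add: proj1_def)
qed

lemma proj2_natural:
  assumes "f \<in> Hom Graph X X'" "g \<in> Hom Graph Y Y'" "v \<in> verts (X \<otimes> Y)"
  shows "proj2 X' Y' (fn (f \<otimes>\<^sub>m g) v) = fn g (proj2 X Y v)"
proof -
  note rg = HomD(3)[OF assms(1)] HomD(4)[OF assms(1)] HomD(3)[OF assms(2)] HomD(4)[OF assms(2)]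
  note c = collapse_Hom[OF rg(1)] and ii = Ident_Hom[OF I_rgraph]
  have "fn (collapse X' \<otimes>\<^sub>m idn Y') (fn (f \<otimes>\<^sub>m g) v) = fn (collapse X \<otimes>\<^sub>m g) v"
    using fn_tensor_Comp[OF assms(1) collapse_Hom[OF rg(2)] assms(2) Ident_Hom[OF rg(4)] assms(3)]
    by (simp add: Graph.id_comp[OF assms(2)] Comp_collapse[OF assms(1)])
  also have "\<dots> = fn (idn I \<otimes>\<^sub>m g) (fn (collapse X \<otimes>\<^sub>m idn Y) v)"
    using fn_tensor_Comp[OF c ii Ident_Hom[OF rg(3)] assms(2) assms(3)]
    by (simp add: Graph.comp_id[OF assms(2)] Graph.id_comp[OF c])
  finally show ?thesis
    using l_natural[OF assms(2) HomD(5)[OF tensor_Hom[OF c Ident_Hom[OF rg(3)]] assms(3)]]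
    by (simp add: proj2_def)
qed

lemma proj_pair:
  assumes "is_rgraph X" "is_rgraph Y" "x \<in> verts X" "y \<in> verts Y"
  shows "proj1 X Y (pair X Y x y) = x" "proj2 X Y (pair X Y x y) = y"
proof -
  have v: "pt2 \<in> verts (I \<otimes> I)" by (simp add: verts_II)
  note px = point_Hom[OF assms(1,3)] and py = point_Hom[OF assms(2,4)]
  show "proj1 X Y (pair X Y x y) = x" "proj2 X Y (pair X Y x y) = y"
    unfolding pair_def proj1_natural[OF px py v] proj2_natural[OF px py v]
    using proj1_Hom(1)[OF I_rgraph I_rgraph v] proj2_Hom(1)[OF I_rgraph I_rgraph v] by simp_all
qed

text \<open>
  A vertex \<open>v\<close> that is not a pair is detected by two maps \<open>X \<otimes> Y \<rightarrow> K\<close> that differ exactly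
  at \<open>v\<close>. Their transposes \<open>Y \<rightarrow> [X, K]\<close> agree on all vertices \<open>y\<close>, because precomposition
  with \<open>X \<otimes> y\<close> sees only \<open>X \<otimes> I \<cong> X\<close>, all of whose vertices come from vertices of \<open>X\<close>.
\<close>

lemma pair_surj:
  assumes X: "is_rgraph X" and Y: "is_rgraph Y" and v: "v \<in> verts (X \<otimes> Y)"
  shows "\<exists>x\<in>verts X. \<exists>y\<in>verts Y. v = pair X Y x y"
proof (rule ccontr)
  assume no: "\<not> ?thesis"
  obtain G e where G: "is_rgraph G" "e \<in> Hom Graph (X \<otimes> G) K"
    "\<And>Y f. is_rgraph Y \<Longrightarrow> f \<in> Hom Graph (X \<otimes> Y) K \<Longrightarrow>
       \<exists>!k. k \<in> Hom Graph Y G \<and> Comp Graph e (idn X \<otimes>\<^sub>m k) = f"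
    using exponential[OF X K_rgraph] by blast
  note XY = tensor_rgraph[OF X Y] and iX = Ident_Hom[OF X] and iI = Ident_Hom[OF I_rgraph]
  \<comment> \<open>Every function into \<open>K\<close> is a graph map, so \<open>f\<close> and \<open>g\<close> are.\<close>
  define f where "f = gmap_of (X \<otimes> Y) K (\<lambda>_. a)"
  define g where "g = gmap_of (X \<otimes> Y) K (\<lambda>w. if w = v then b else a)"
  have f: "f \<in> Hom Graph (X \<otimes> Y) K" and g: "g \<in> Hom Graph (X \<otimes> Y) K"
    unfolding f_def g_def by (rule gmap_of_Hom[OF XY K_rgraph]; auto)+
  obtain k k' where k: "k \<in> Hom Graph Y G" "Comp Graph e (idn X \<otimes>\<^sub>m k) = f"
    and k': "k' \<in> Hom Graph Y G" "Comp Graph e (idn X \<otimes>\<^sub>m k') = g"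
    using G(3)[OF Y f] G(3)[OF Y g] by blast
  have tens: "fn (idn X \<otimes>\<^sub>m Comp Graph h (point_map Y y)) w = fn (idn X \<otimes>\<^sub>m h) (fn (idn X \<otimes>\<^sub>m point_map Y y) w)"
    if "y \<in> verts Y" "h \<in> Hom Graph Y G" "w \<in> verts (X \<otimes> I)" for h y w
    using fn_tensor_Comp[OF iX iX point_Hom[OF Y that(1)] that(2,3)] by (simp add: Graph.id_comp[OF iX])
  have "k = k'"
  proof (rule gmap_eqI[OF k(1) k'(1)])
    fix y assume y: "y \<in> verts Y"
    note py = point_Hom[OF Y y]
    let ?m = "Comp Graph k (point_map Y y)" and ?m' = "Comp Graph k' (point_map Y y)"
    have m: "?m \<in> Hom Graph I G" "?m' \<in> Hom Graph I G" using Comp_Hom[OF py] k k' by auto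
    have eq: "Comp Graph e (idn X \<otimes>\<^sub>m ?m) = Comp Graph e (idn X \<otimes>\<^sub>m ?m')"
    proof (rule gmap_eqI[OF Comp_Hom[OF tensor_Hom[OF iX m(1)] G(2)] Comp_Hom[OF tensor_Hom[OF iX m(2)] G(2)]])
      fix w assume w: "w \<in> verts (X \<otimes> I)"
      let ?x = "fn (r X) w"
      have x: "?x \<in> verts X" using HomD(5)[OF r_iso(1)[OF X] w] .
      note px = point_Hom[OF X x]
      let ?w = "fn (point_map X ?x \<otimes>\<^sub>m idn I) pt2"
      have "?w \<in> verts (X \<otimes> I)" using HomD(5)[OF tensor_Hom[OF px iI]] by (simp add: verts_II)
      moreover have "fn (r X) ?w = ?x"
        using r_natural[OF px, of pt2] HomD(5)[OF r_iso(1)[OF I_rgraph], of pt2] by (simp add: verts_II)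
      ultimately have "w = ?w" using w r_iso(2)[OF X] by (auto simp: bij_betw_def dest: inj_onD)
      moreover have "fn (idn X \<otimes>\<^sub>m point_map Y y) ?w = pair X Y ?x y"
        using fn_tensor_Comp[OF px iX iI py, of pt2]
        by (simp add: verts_II pair_def Graph.id_comp[OF px] Graph.comp_id[OF py])
      ultimately have wp: "fn (idn X \<otimes>\<^sub>m point_map Y y) w = pair X Y ?x y" by simp
      have "pair X Y ?x y \<noteq> v" using no x y by blast
      then have "fn f (pair X Y ?x y) = fn g (pair X Y ?x y)"
        using pair_verts[OF X Y x y] by (simp add: f_def g_def)
      then show "fn (Comp Graph e (idn X \<otimes>\<^sub>m ?m)) w = fn (Comp Graph e (idn X \<otimes>\<^sub>m ?m')) w"
        using w pair_verts[OF X Y x y] HomD(1)[OF tensor_Hom[OF iX m(1)]] HomD(1)[OF tensor_Hom[OF iX m(2)]]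
          HomD(1)[OF tensor_Hom[OF iX k(1)]] HomD(1)[OF tensor_Hom[OF iX k'(1)]]
        by (simp add: tens[OF y k(1)] tens[OF y k'(1)] wp k(2)[symmetric] k'(2)[symmetric])
    qed
    have "?m = ?m'"
      using G(3)[OF I_rgraph Comp_Hom[OF tensor_Hom[OF iX m(2)] G(2)]] m eq by blast
    then have "fn ?m pt = fn ?m' pt" by simp
    then show "fn k y = fn k' y" by (simp add: HomD(1)[OF py] verts_I)
  qed
  then have "f = g" using k k' by simp
  then have "fn f v = fn g v" by simp
  then show False using v ab by (simp add: f_def g_def)
qed

lemma gmap_eq_on_pairs:
  assumes "f \<in> Hom Graph (X \<otimes> Y) Z" "g \<in> Hom Graph (X \<otimes> Y) Z" "is_rgraph X" "is_rgraph Y"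
    "\<And>x y. x \<in> verts X \<Longrightarrow> y \<in> verts Y \<Longrightarrow> fn f (pair X Y x y) = fn g (pair X Y x y)"
  shows "f = g"
  using gmap_eqI[OF assms(1,2)] pair_surj[OF assms(3,4)] assms(5) by metis

section \<open>Edges of a tensor product\<close>

text \<open>
  Together with \<open>edge_left\<close> below: every edge of the box product is an edge of \<open>X \<otimes> Y\<close>.
  In the other direction, \<open>proj1\<close> and \<open>proj2\<close> are graph maps, so every edge of \<open>X \<otimes> Y\<close> is
  one of the categorical product.
\<close>

lemma edge_right:
  assumes X: "is_rgraph X" and Y: "is_rgraph Y" and x: "x \<in> verts X" and e: "(y, y') \<in> edges Y"
  shows "(pair X Y x y, pair X Y x y') \<in> edges (X \<otimes> Y)"
proof -
  have y: "y \<in> verts Y" "y' \<in> verts Y" using edge_verts[OF Y e] by auto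
  have lp: "fn (l Y) (pair I Y pt z) = z" if "z \<in> verts Y" for z
  proof -
    have "collapse I = idn I"
      by (rule gmap_eqI[OF collapse_Hom Ident_Hom]) (auto simp: I_rgraph verts_I)
    then show ?thesis
      using l_natural[OF point_Hom[OF Y that], of pt2] HomD(5)[OF l_iso(1)[OF I_rgraph], of pt2]
      by (simp add: verts_II pair_def)
  qed
  have "(pair I Y pt y, pair I Y pt y') \<in> edges (I \<otimes> Y)"
    by (rule l_iso(3)[OF Y]) (use y e in \<open>auto simp: lp pair_verts I_rgraph Y verts_I\<close>)
  from HomD(6)[OF tensor_Hom[OF point_Hom[OF X x] Ident_Hom[OF Y]] this]
  show ?thesis
    using y by (simp add: fn_tensor_pair[OF point_Hom[OF X x] Ident_Hom[OF Y]] verts_I)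
qed

lemma \<gamma>_pair:
  assumes "is_rgraph X" "is_rgraph Y" "x \<in> verts X" "y \<in> verts Y"
  shows "fn (\<gamma> (X, Y)) (pair X Y x y) = pair Y X y x"
  using \<gamma>_natural[OF point_Hom[OF assms(1,3)] point_Hom[OF assms(2,4)], of pt2]
    HomD(5)[OF \<gamma>_Hom[OF I_rgraph I_rgraph], of pt2] by (simp add: verts_II pair_def)

lemma edge_left:
  assumes X: "is_rgraph X" and Y: "is_rgraph Y" and y: "y \<in> verts Y" and e: "(x, x') \<in> edges X"
  shows "(pair X Y x y, pair X Y x' y) \<in> edges (X \<otimes> Y)"
  using HomD(6)[OF \<gamma>_Hom[OF Y X] edge_right[OF Y X y e]] edge_verts[OF X e] y
  by (simp add: \<gamma>_pair[OF Y X])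

text \<open>
  The function \<open>h\<close> on pairs of vertices is the vertex function of a graph map
  \<open>X \<otimes> Y \<rightarrow> Z\<close>.
\<close>

definition extends where
  "extends X Y Z h \<longleftrightarrow> (\<exists>q \<in> Hom Graph (X \<otimes> Y) Z. \<forall>x\<in>verts X. \<forall>y\<in>verts Y. fn q (pair X Y x y) = h x y)"

lemma extends_swap:
  assumes "is_rgraph X" "is_rgraph Y" "extends X Y Z h"
  shows "extends Y X Z (\<lambda>y x. h x y)"
proof -
  obtain q where q: "q \<in> Hom Graph (X \<otimes> Y) Z" "\<forall>x\<in>verts X. \<forall>y\<in>verts Y. fn q (pair X Y x y) = h x y"
    using assms(3) by (auto simp: extends_def)
  show ?thesis
    unfolding extends_def
    by (rule bexI[OF _ Comp_Hom[OF \<gamma>_Hom[OF assms(2,1)] q(1)]])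
      (simp add: HomD(1)[OF \<gamma>_Hom[OF assms(2,1)]] pair_verts assms(1,2) \<gamma>_pair q(2))
qed

text \<open>
  As \<open>A \<otimes> -\<close> preserves colimits and \<open>Y\<close> is a colimit of its edges, a function on \<open>A \<otimes> Y\<close>
  is a graph map once it is one on \<open>A \<otimes> u\<close> for each edge \<open>u : K \<rightarrow> Y\<close>. In the proof, the
  transposes \<open>k u : K \<rightarrow> [A, Z]\<close> are glued to a map \<open>m : Y \<rightarrow> [A, Z]\<close>; a vertex \<open>y\<close> is
  treated as the degenerate edge at \<open>y\<close>.
\<close>

lemma extends_glue:
  assumes A: "is_rgraph A" and Y: "is_rgraph Y" and Z: "is_rgraph Z"
    and h: "\<And>u. u \<in> Hom Graph K Y \<Longrightarrow> extends A K Z (\<lambda>x t. h x (fn u t))"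
  shows "extends A Y Z h"
proof -
  obtain G e where G: "is_rgraph G" "e \<in> Hom Graph (A \<otimes> G) Z"
    "\<And>Y f. is_rgraph Y \<Longrightarrow> f \<in> Hom Graph (A \<otimes> Y) Z \<Longrightarrow>
       \<exists>!k. k \<in> Hom Graph Y G \<and> Comp Graph e (idn A \<otimes>\<^sub>m k) = f"
    using exponential[OF A Z] by blast
  note iA = Ident_Hom[OF A]
  have transpose: "fn (Comp Graph e (idn A \<otimes>\<^sub>m k)) (pair A W x t) = fn e (pair A G x (fn k t))"
    if "k \<in> Hom Graph W G" "x \<in> verts A" "t \<in> verts W" for k W x t
    using that by (simp add: HomD(1)[OF tensor_Hom[OF iA that(1)]] fn_tensor_pair[OF iA that(1)]
        pair_verts A HomD(3)[OF that(1)])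
  have "\<exists>k. k \<in> Hom Graph K G \<and> (\<forall>x\<in>verts A. \<forall>t\<in>verts K. fn e (pair A G x (fn k t)) = h x (fn u t))"
    if u: "u \<in> Hom Graph K Y" for u
  proof -
    obtain q where q: "q \<in> Hom Graph (A \<otimes> K) Z"
      "\<forall>x\<in>verts A. \<forall>t\<in>verts K. fn q (pair A K x t) = h x (fn u t)"
      using h[OF u] by (auto simp: extends_def)
    obtain k where k: "k \<in> Hom Graph K G" "Comp Graph e (idn A \<otimes>\<^sub>m k) = q" using G(3)[OF K_rgraph q(1)] by blast
    then show ?thesis using transpose[OF k(1)] q(2) by auto
  qed
  then obtain k where k: "\<And>u. u \<in> Hom Graph K Y \<Longrightarrow> k u \<in> Hom Graph K G"
    and ek: "\<And>u x t. u \<in> Hom Graph K Y \<Longrightarrow> x \<in> verts A \<Longrightarrow> t \<in> verts K \<Longrightarrow>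
      fn e (pair A G x (fn (k u) t)) = h x (fn u t)"
    by metis
  define m where "m y = fn (k (const_gmap K Y y)) a" for y
  have cy: "const_gmap K Y y \<in> Hom Graph K Y" if "y \<in> verts Y" for y
    using that by (intro const_gmap_Hom K_rgraph Y)
  have km: "fn (k u) t = m (fn u t)" if u: "u \<in> Hom Graph K Y" and t: "t \<in> verts K" for u t
  proof -
    note ct = const_gmap_Hom[OF K_rgraph K_rgraph t]
    note c = Comp_Hom[OF ct k[OF u]]
    have ut: "fn u t \<in> verts Y" using HomD(5)[OF u t] .
    note k' = k[OF cy[OF ut]]
    let ?q = "\<lambda>k. Comp Graph e (idn A \<otimes>\<^sub>m k)"
    have q: "?q k \<in> Hom Graph (A \<otimes> K) Z" if "k \<in> Hom Graph K G" for k
      by (rule Comp_Hom[OF tensor_Hom[OF iA that] G(2)])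
    have "?q (Comp Graph (k u) (const_gmap K K t)) = ?q (k (const_gmap K Y (fn u t)))"
    proof (rule gmap_eq_on_pairs[OF q[OF c] q[OF k'] A K_rgraph])
      fix x s assume xs: "x \<in> verts A" "s \<in> verts K"
      have "fn (Comp Graph (k u) (const_gmap K K t)) s = fn (k u) t"
        using xs(2) HomD(1)[OF ct] by (simp del: verts_complete_pair)
      then show "fn (?q (Comp Graph (k u) (const_gmap K K t))) (pair A K x s)
          = fn (?q (k (const_gmap K Y (fn u t)))) (pair A K x s)"
        using transpose[OF c xs] transpose[OF k' xs] ek[OF u xs(1) t] ek[OF cy[OF ut] xs] xs(2)
        by (simp del: verts_complete_pair)
    qed
    then have "Comp Graph (k u) (const_gmap K K t) = k (const_gmap K Y (fn u t))"
      using G(3)[OF K_rgraph q[OF k']] c k' by blast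
    then have "fn (Comp Graph (k u) (const_gmap K K t)) a = m (fn u t)" by (simp add: m_def)
    then show ?thesis using HomD(1)[OF ct] by simp
  qed
  have mH: "gmap_of Y G m \<in> Hom Graph Y G"
  proof (rule gmap_of_Hom[OF Y G(1)])
    show "m y \<in> verts G" if "y \<in> verts Y" for y
      unfolding m_def using HomD(5)[OF k[OF cy[OF that]]] by simp
    show "(m y, m y') \<in> edges G" if yy: "(y, y') \<in> edges Y" for y y'
    proof -
      let ?u = "gmap_of K Y (\<lambda>t. if t = a then y else y')"
      have u: "?u \<in> Hom Graph K Y"
        using edge_verts[OF Y yy] edge_sym[OF Y yy] edge_refl[OF Y] yy
        by (intro gmap_of_Hom K_rgraph Y) auto
      have "(fn (k ?u) a, fn (k ?u) b) \<in> edges G" using HomD(6)[OF k[OF u]] by simp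
      then show ?thesis using km[OF u] ab by simp
    qed
  qed
  show ?thesis
    unfolding extends_def
  proof (intro bexI ballI)
    show "Comp Graph e (idn A \<otimes>\<^sub>m gmap_of Y G m) \<in> Hom Graph (A \<otimes> Y) Z"
      by (rule Comp_Hom[OF tensor_Hom[OF iA mH] G(2)])
    fix x y assume xy: "x \<in> verts A" "y \<in> verts Y"
    show "fn (Comp Graph e (idn A \<otimes>\<^sub>m gmap_of Y G m)) (pair A Y x y) = h x y"
      using transpose[OF mH xy] ek[OF cy[OF xy(2)] xy(1), of a] xy by (simp add: m_def)
  qed
qed

lemma extends_glue2:
  assumes X: "is_rgraph X" and Y: "is_rgraph Y" and Z: "is_rgraph Z"
    and h: "\<And>u u'. u \<in> Hom Graph K X \<Longrightarrow> u' \<in> Hom Graph K Y \<Longrightarrow> extends K K Z (\<lambda>s t. h (fn u s) (fn u' t))"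
  shows "extends X Y Z h"
proof (rule extends_glue[OF X Y Z])
  fix u' assume u': "u' \<in> Hom Graph K Y"
  have "extends K X Z (\<lambda>t x. h x (fn u' t))"
    by (rule extends_glue[OF K_rgraph X Z], rule extends_swap[OF K_rgraph K_rgraph h[OF _ u']])
  then show "extends X K Z (\<lambda>x t. h x (fn u' t))"
    by (rule extends_swap[OF K_rgraph X])
qed

section \<open>Classification\<close>

lemma naturally_isomorphic_product:
  assumes gp: "graph_product p E"
    and edges: "\<And>X Y x x' y y'. is_rgraph X \<Longrightarrow> is_rgraph Y \<Longrightarrow> x \<in> verts X \<Longrightarrow> x' \<in> verts X \<Longrightarrow>
      y \<in> verts Y \<Longrightarrow> y' \<in> verts Y \<Longrightarrow>
      (pair X Y x y, pair X Y x' y') \<in> edges (X \<otimes> Y) \<longleftrightarrow> E X Y (x, y) (x', y')"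
  shows "naturally_isomorphic (Graph \<times>\<^sub>C Graph) Graph T (product_ftor p E)"
proof -
  interpret P: graph_product p E by fact
  define \<eta> where "\<eta> = (\<lambda>(X, Y). gmap_of (X \<otimes> Y) (P.P X Y) (\<lambda>v. p (proj1 X Y v, proj2 X Y v)))"
  have \<eta>: "\<eta> (X, Y) \<in> Hom Graph (X \<otimes> Y) (P.P X Y)" "iso Graph (\<eta> (X, Y))"
    if X: "is_rgraph X" and Y: "is_rgraph Y" for X Y
  proof -
    have "(v, w) \<in> edges (X \<otimes> Y) \<longleftrightarrow>
        (p (proj1 X Y v, proj2 X Y v), p (proj1 X Y w, proj2 X Y w)) \<in> edges (P.P X Y)"
      if v: "v \<in> verts (X \<otimes> Y)" and w: "w \<in> verts (X \<otimes> Y)" for v w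
    proof -
      obtain x y where "x \<in> verts X" "y \<in> verts Y" "v = pair X Y x y" using pair_surj[OF X Y v] by blast
      moreover obtain x' y' where "x' \<in> verts X" "y' \<in> verts Y" "w = pair X Y x' y'"
        using pair_surj[OF X Y w] by blast
      ultimately show ?thesis by (simp add: edges[OF X Y] proj_pair X Y)
    qed
    then show "\<eta> (X, Y) \<in> Hom Graph (X \<otimes> Y) (P.P X Y)" "iso Graph (\<eta> (X, Y))"
      unfolding \<eta>_def prod.case
      by (intro gmap_of_iso[where h' = "\<lambda>w. case inv p w of (x, y) \<Rightarrow> pair X Y x y"];
          auto simp: tensor_rgraph P.P_rgraph X Y proj1_Hom proj2_Hom pair_verts proj_pair
            elim!: P.P_vertsE dest!: pair_surj[OF X Y])+
  qed
  have "nat_iso (Graph \<times>\<^sub>C Graph) Graph T (product_ftor p E) \<eta>"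
  proof (rule nat_isoI[OF T_functor P.T_functor], goal_cases)
    case (1 c) then show ?case by (auto simp: Obj_prod \<eta>)
  next
    case (2 c) then show ?case by (auto simp: Obj_prod \<eta>)
  next
    case (3 h c d)
    obtain X Y X' Y' f g where eqs: "c = (X, Y)" "d = (X', Y')" "h = (f, g)"
      by (metis surj_pair)
    then have f: "f \<in> Hom Graph X X'" and g: "g \<in> Hom Graph Y Y'"
      and rg: "is_rgraph X" "is_rgraph Y" "is_rgraph X'" "is_rgraph Y'"
      using 3 by (auto simp: Hom_prod Obj_prod)
    note \<eta>H = \<eta>(1)[OF rg(1,2)] and \<eta>H' = \<eta>(1)[OF rg(3,4)]
    have "Comp Graph (on_arr (product_ftor p E) (f, g)) (\<eta> (X, Y)) = Comp Graph (\<eta> (X', Y')) (f \<otimes>\<^sub>m g)"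
    proof (rule gmap_eqI[OF Comp_Hom[OF \<eta>H P.T_Hom(1)[OF f g]] Comp_Hom[OF tensor_Hom[OF f g] \<eta>H']])
      fix v assume v: "v \<in> verts (X \<otimes> Y)"
      note v' = HomD(5)[OF tensor_Hom[OF f g] v]
      show "fn (Comp Graph (on_arr (product_ftor p E) (f, g)) (\<eta> (X, Y))) v
          = fn (Comp Graph (\<eta> (X', Y')) (f \<otimes>\<^sub>m g)) v"
        using v v' HomD(1)[OF tensor_Hom[OF f g]]
        by (simp add: \<eta>_def P.T_Hom(2)[OF f g] proj1_Hom[OF rg(1,2)] proj2_Hom[OF rg(1,2)]
            proj1_natural[OF f g] proj2_natural[OF f g])
    qed
    then show ?case by (simp add: eqs)
  qed
  then show ?thesis by (auto simp: naturally_isomorphic_def)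
qed

text \<open>
  Everything is decided by whether \<open>(a, a)\<close> and \<open>(b, b)\<close> are joined in \<open>K \<otimes> K\<close>. If they
  are, pushing this edge forward along pairs of edges gives every edge of the categorical
  product. If not, then automorphisms of \<open>K\<close> exclude the other diagonal too, so \<open>K \<otimes> K\<close> is
  the box product and gluing makes the identity of pairs a graph map from \<open>X \<otimes> Y\<close> to the
  box product.
\<close>

lemma tensor_box_or_categorical:
  assumes inj: "inj (p :: 'u \<times> 'u \<Rightarrow> 'u)"
  shows "naturally_isomorphic (Graph \<times>\<^sub>C Graph) Graph T (box_product p)
    \<or> naturally_isomorphic (Graph \<times>\<^sub>C Graph) Graph T (categorical_product p)"
proof (cases "(pair K K a a, pair K K b b) \<in> edges (K \<otimes> K)")
  case True
  have "graph_product p cat_edge" using univ inj by unfold_locales auto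
  then have "naturally_isomorphic (Graph \<times>\<^sub>C Graph) Graph T (product_ftor p cat_edge)"
  proof (rule naturally_isomorphic_product)
    fix X Y :: "'u rgraph" and x x' y y'
    assume X: "is_rgraph X" and Y: "is_rgraph Y"
      and v: "x \<in> verts X" "x' \<in> verts X" "y \<in> verts Y" "y' \<in> verts Y"
    show "(pair X Y x y, pair X Y x' y') \<in> edges (X \<otimes> Y) \<longleftrightarrow> cat_edge X Y (x, y) (x', y')"
    proof
      assume "(pair X Y x y, pair X Y x' y') \<in> edges (X \<otimes> Y)"
      then show "cat_edge X Y (x, y) (x', y')"
        using proj1_Hom(2)[OF X Y] proj2_Hom(2)[OF X Y] v
        by (fastforce simp: cat_edge_def proj_pair X Y)
    next
      assume "cat_edge X Y (x, y) (x', y')"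
      then have e: "(x, x') \<in> edges X" "(y, y') \<in> edges Y"
        using v edge_refl[OF X] edge_refl[OF Y] by (auto simp: cat_edge_def)
      let ?u = "gmap_of K X (\<lambda>t. if t = a then x else x')" and ?u' = "gmap_of K Y (\<lambda>t. if t = a then y else y')"
      have "?u \<in> Hom Graph K X" "?u' \<in> Hom Graph K Y"
        using v e edge_sym[OF X e(1)] edge_sym[OF Y e(2)] edge_refl[OF X] edge_refl[OF Y]
        by (auto intro!: gmap_of_Hom K_rgraph X Y)
      then show "(pair X Y x y, pair X Y x' y') \<in> edges (X \<otimes> Y)"
        using HomD(6)[OF tensor_Hom True] fn_tensor_pair ab by fastforce
    qed
  qed
  then show ?thesis by (simp add: categorical_product_def)
next
  case False
  have gp: "graph_product p box_edge" using univ inj by unfold_locales auto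
  interpret P: graph_product p box_edge by (rule gp)
  have no_diag: "s = s' \<or> t = t'"
    if "(pair K K s t, pair K K s' t') \<in> edges (K \<otimes> K)" "s \<in> verts K" "t \<in> verts K" "s' \<in> verts K" "t' \<in> verts K"
    for s t s' t'
  proof (rule ccontr)
    assume "\<not> (s = s' \<or> t = t')"
    then have ne: "s' \<noteq> s" "t' \<noteq> t" by auto
    let ?u = "gmap_of K K (\<lambda>q. if q = s then a else b)" and ?u' = "gmap_of K K (\<lambda>q. if q = t then a else b)"
    have "?u \<in> Hom Graph K K" "?u' \<in> Hom Graph K K"
      by (auto intro!: gmap_of_Hom K_rgraph)
    from HomD(6)[OF tensor_Hom[OF this] that(1)] fn_tensor_pair[OF this] that(2-)
    have "(pair K K a a, pair K K b b) \<in> edges (K \<otimes> K)" using ne by (simp del: verts_complete_pair)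
    then show False using False by simp
  qed
  have "naturally_isomorphic (Graph \<times>\<^sub>C Graph) Graph T (product_ftor p box_edge)"
  proof (rule naturally_isomorphic_product[OF gp])
    fix X Y :: "'u rgraph" and x x' y y'
    assume X: "is_rgraph X" and Y: "is_rgraph Y"
      and v: "x \<in> verts X" "x' \<in> verts X" "y \<in> verts Y" "y' \<in> verts Y"
    \<comment> \<open>The identity of pairs, from \<open>X \<otimes> Y\<close> to the box product.\<close>
    have "extends X Y (P.P X Y) (\<lambda>x y. p (x, y))"
    proof (rule extends_glue2[OF X Y P.P_rgraph[OF X Y]])
      fix u u' assume u: "u \<in> Hom Graph K X" and u': "u' \<in> Hom Graph K Y"
      let ?q = "gmap_of (K \<otimes> K) (P.P X Y) (\<lambda>v. p (fn u (proj1 K K v), fn u' (proj2 K K v)))"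
      have "?q \<in> Hom Graph (K \<otimes> K) (P.P X Y)"
      proof (rule gmap_of_Hom[OF tensor_rgraph[OF K_rgraph K_rgraph] P.P_rgraph[OF X Y]])
        fix v assume "v \<in> verts (K \<otimes> K)"
        then show "p (fn u (proj1 K K v), fn u' (proj2 K K v)) \<in> verts (P.P X Y)"
          using HomD(5)[OF u] HomD(5)[OF u'] proj1_Hom(1)[OF K_rgraph K_rgraph] proj2_Hom(1)[OF K_rgraph K_rgraph]
          by (simp del: verts_complete_pair)
      next
        fix v w assume vw: "(v, w) \<in> edges (K \<otimes> K)"
        then have "v \<in> verts (K \<otimes> K)" "w \<in> verts (K \<otimes> K)"
          using edge_verts[OF tensor_rgraph[OF K_rgraph K_rgraph]] by blast+
        then obtain s t s' t' where st: "s \<in> verts K" "t \<in> verts K" "s' \<in> verts K" "t' \<in> verts K"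
          and vw': "v = pair K K s t" "w = pair K K s' t'"
          using pair_surj[OF K_rgraph K_rgraph] by metis
        have "box_edge X Y (fn u s, fn u' t) (fn u s', fn u' t')"
          using no_diag[OF vw[unfolded vw'] st] HomD(6)[OF u, of s s'] HomD(6)[OF u', of t t'] st
          by (auto simp: box_edge_def)
        then show "(p (fn u (proj1 K K v), fn u' (proj2 K K v)), p (fn u (proj1 K K w), fn u' (proj2 K K w)))
            \<in> edges (P.P X Y)"
          using st HomD(5)[OF u] HomD(5)[OF u']
          by (simp add: vw' proj_pair[OF K_rgraph K_rgraph] del: verts_complete_pair)
      qed
      then show "extends K K (P.P X Y) (\<lambda>s t. p (fn u s, fn u' t))"
        unfolding extends_def
        by (rule bexI[rotated]) (simp add: pair_verts[OF K_rgraph K_rgraph] proj_pair[OF K_rgraph K_rgraph]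
            del: verts_complete_pair)
    qed
    then obtain q where q: "q \<in> Hom Graph (X \<otimes> Y) (P.P X Y)"
      "\<And>x y. x \<in> verts X \<Longrightarrow> y \<in> verts Y \<Longrightarrow> fn q (pair X Y x y) = p (x, y)"
      by (auto simp: extends_def)
    show "(pair X Y x y, pair X Y x' y') \<in> edges (X \<otimes> Y) \<longleftrightarrow> box_edge X Y (x, y) (x', y')"
    proof
      assume "(pair X Y x y, pair X Y x' y') \<in> edges (X \<otimes> Y)"
      from HomD(6)[OF q(1) this] show "box_edge X Y (x, y) (x', y')" using v by (simp add: q(2))
    next
      assume "box_edge X Y (x, y) (x', y')"
      then show "(pair X Y x y, pair X Y x' y') \<in> edges (X \<otimes> Y)"
        using v by (auto simp: box_edge_def intro: edge_left[OF X Y] edge_right[OF X Y])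
    qed
  qed
  then show ?thesis by (simp add: box_product_def)
qed

end

section \<open>The two closed symmetric monoidal products\<close>

text \<open>
  The categorical square of the edge graph is complete, whereas in its box square the
  opposite corners \<open>(a, a)\<close> and \<open>(b, b)\<close> are not joined.
\<close>

lemma box_not_isomorphic_categorical:
  fixes p :: "'u \<times> 'u \<Rightarrow> 'u"
  assumes univ: "universe TYPE('u)" and inj: "inj p" and ab: "(a :: 'u) \<noteq> b"
  shows "\<not> naturally_isomorphic (Graph \<times>\<^sub>C Graph) Graph (box_product p) (categorical_product p)"
proof
  assume "naturally_isomorphic (Graph \<times>\<^sub>C Graph) Graph (box_product p) (categorical_product p)"
  then obtain \<eta> where \<eta>: "nat_iso (Graph \<times>\<^sub>C Graph) Graph (product_ftor p box_edge) (product_ftor p cat_edge) \<eta>"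
    by (auto simp: naturally_isomorphic_def box_product_def categorical_product_def)
  interpret nat_iso "Graph \<times>\<^sub>C Graph" Graph "product_ftor p box_edge" "product_ftor p cat_edge" \<eta> by fact
  interpret B: graph_product p box_edge using univ inj by unfold_locales auto
  interpret C: graph_product p cat_edge using univ inj by unfold_locales auto
  let ?K = "complete_pair a b"
  have o: "(?K, ?K) \<in> Obj (Graph \<times>\<^sub>C Graph)" using complete_pair_rgraph[OF univ] by (simp add: Obj_prod)
  have H: "\<eta> (?K, ?K) \<in> Hom Graph (B.P ?K ?K) (C.P ?K ?K)" using component[OF o] by simp
  have v: "p (a, a) \<in> verts (B.P ?K ?K)" "p (b, b) \<in> verts (B.P ?K ?K)" by simp_all
  have "(fn (\<eta> (?K, ?K)) (p (a, a)), fn (\<eta> (?K, ?K)) (p (b, b))) \<in> edges (C.P ?K ?K)"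
    using HomD(5)[OF H v(1)] HomD(5)[OF H v(2)]
    by (elim C.P_vertsE) (auto simp: cat_edge_def)
  then have "(p (a, a), p (b, b)) \<in> edges (B.P ?K ?K)"
    using graph_isoD(2)[OF component_iso[OF o] H v] by simp
  then show False using ab by (simp add: box_edge_def)
qed

theorem theorem4p11:
  fixes p :: "'u \<times> 'u \<Rightarrow> 'u"
  assumes "universe TYPE('u)" and "inj p"
  shows "closed_symmetric_monoidal_product Graph (box_product p)
    \<and> closed_symmetric_monoidal_product Graph (categorical_product p)
    \<and> \<not> naturally_isomorphic (Graph \<times>\<^sub>C Graph) Graph (box_product p) (categorical_product p)
    \<and> (\<forall>T :: ('u rgraph, 'u gmap) bifunctor.
         closed_symmetric_monoidal_product Graph T \<longrightarrow>
           naturally_isomorphic (Graph \<times>\<^sub>C Graph) Graph T (box_product p)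
         \<or> naturally_isomorphic (Graph \<times>\<^sub>C Graph) Graph T (categorical_product p))"
proof (intro conjI allI impI)
  interpret B: graph_product p box_edge using assms by unfold_locales auto
  interpret C: graph_product p cat_edge using assms by unfold_locales auto
  have "infinite (UNIV :: 'u set)" using assms(1) by (simp add: universe_def)
  then obtain a b :: 'u where ab: "a \<noteq> b"
    by (metis (full_types) UNIV_eq_I finite.emptyI finite_insert insertI1)
  show "closed_symmetric_monoidal_product Graph (box_product p)"
    using B.closed_symmetric_monoidal_product_T by (simp add: box_product_def)
  show "closed_symmetric_monoidal_product Graph (categorical_product p)"
    using C.closed_symmetric_monoidal_product_T by (simp add: categorical_product_def)
  show "\<not> naturally_isomorphic (Graph \<times>\<^sub>C Graph) Graph (box_product p) (categorical_product p)"
    by (rule box_not_isomorphic_categorical[OF assms ab])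
  fix T :: "('u rgraph, 'u gmap) bifunctor"
  assume T: "closed_symmetric_monoidal_product Graph T"
  then obtain I \<alpha> l r \<gamma> where "symmetric_monoidal Graph T I \<alpha> l r \<gamma>"
    by (auto simp: closed_symmetric_monoidal_product_def)
  then have "closed_tensor T I \<alpha> l r \<gamma> a b"
    using T ab assms(1) unfolding closed_tensor_def closed_symmetric_monoidal_product_def by blast
  then interpret closed_tensor T I \<alpha> l r \<gamma> a b .
  show "naturally_isomorphic (Graph \<times>\<^sub>C Graph) Graph T (box_product p)
         \<or> naturally_isomorphic (Graph \<times>\<^sub>C Graph) Graph T (categorical_product p)"
    by (rule tensor_box_or_categorical[OF assms(2)])
qed

end
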